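(* Let $A,B$ be self-adjoint operators on a Hilbert space $\mathcal H$ and $\psi\in\mathcal H$ a unit vector. The following are equivalent: (i) $\psi\in\mathrm{ran}\,[\![\tilde A=\tilde B]\!]$; (ii) $E^A(r)\psi=E^B(r)\psi$ for every $r\in\mathbf Q$; (iii) $f(A)\psi=f(B)\psi$ for every bounded complex-valued Borel function $f$ on $\mathbb R$; (iv) $\langle E^A(\Delta)\psi,E^B(\Gamma)\psi\rangle=0$ for all Borel sets $\Delta,\Gamma\subseteq\mathbb R$ with $\Delta\cap\Gamma=\emptyset$; (v) there exists a joint probability distribution $\mu^{A,B}_\psi$ of $A$ and $B$ in $\psi$ satisfying $\mu^{A,B}_\psi(\{(a,b)\in\mathbb R^2: a=b\})=1$.
   Context: $\mathcal Q(\mathcal H)$ is the lattice of all orthogonal projections on $\mathcal H$ (order by inclusion of ranges, $\wedge,\vee$ = projections onto intersection / closed span of union of ranges, $P^\perp=1-P$), $P\Rightarrow Q=P^\perp\vee(P\wedge Q)$. $V^{(\mathcal Q(\mathcal H))}=\bigcup_\alpha V_\alpha$ where $V_\alpha$ is the set of functions $u$ with values in $\mathcal Q(\mathcal H)$ and $\mathrm{dom}(u)\subseteq\bigcup_{\beta<\alpha}V_\beta$. Truth values: $[\![u=v]\!]=\bigwedge_{u'\in\mathrm{dom}(u)}(u(u')\Rightarrow[\![u'\in v]\!])\wedge\bigwedge_{v'\in\mathrm{dom}(v)}(v(v')\Rightarrow[\![v'\in u]\!])$, $[\![u\in v]\!]=\bigvee_{v'\in\mathrm{dom}(v)}(v(v')\wedge[\![u=v']\!])$.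 For a set $v$, $\check v=\{(\check w,1):w\in v\}$; $\mathbf Q$ is the rationals. For self-adjoint $A$ with resolution of identity $E^A(\lambda)$, $\tilde A\in V^{(\mathcal Q(\mathcal H))}$ has $\mathrm{dom}(\tilde A)=\{\check r:r\in\mathbf Q\}$ and $\tilde A(\check r)=E^A(r)$. $f(A)=\int f(\lambda)\,dE^A(\lambda)$ and $E^A(\Delta)=\chi_\Delta(A)$ for Borel $\Delta$. A joint probability distribution of $A,B$ in $\psi$ is a probability measure $\mu^{A,B}_\psi$ on $\mathbb R^2$ with $\mu^{A,B}_\psi(\Delta\times\Gamma)=\langle\psi,(E^A(\Delta)\wedge E^B(\Gamma))\psi\rangle$ for all Borel $\Delta,\Gamma\subseteq\mathbb R$. *)

theory Defs
  imports
    "HOL-Probability.Probability_Measure"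
    "HOL-Library.Countable_Set_Type"
    "HOL-Library.Multiset"
begin

section \<open>Complex Hilbert spaces\<close>

text \<open>
  A complex Hilbert space of arbitrary dimension, layered on the real one: the norm, metric and
  topology are those of \<^class>\<open>real_inner\<close>, and the real inner product is the real part of the
  complex one, so that \<open>cinner x x = (norm x)\<^sup>2\<close>. The form is antilinear in its first argument.
\<close>

class chilbert_space = real_inner + complete_space +
  fixes scaleC :: "complex \<Rightarrow> 'a \<Rightarrow> 'a" (infixr "*\<^sub>C" 75)
    and cinner :: "'a \<Rightarrow> 'a \<Rightarrow> complex"
  assumes scaleC_add_right: "c *\<^sub>C (x + y) = c *\<^sub>C x + c *\<^sub>C y"
    and scaleC_add_left: "(c + d) *\<^sub>C x = c *\<^sub>C x + d *\<^sub>C x"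
    and scaleC_scaleC: "c *\<^sub>C (d *\<^sub>C x) = (c * d) *\<^sub>C x"
    and scaleC_of_real: "complex_of_real r *\<^sub>C x = r *\<^sub>R x"
    and cinner_commute: "cinner x y = cnj (cinner y x)"
    and cinner_add_right: "cinner x (y + z) = cinner x y + cinner x z"
    and cinner_scaleC_right: "cinner x (c *\<^sub>C y) = c * cinner x y"
    and Re_cinner: "Re (cinner x y) = inner x y"

definition csubspace :: "'a::chilbert_space set \<Rightarrow> bool" where
  "csubspace M \<longleftrightarrow> 0 \<in> M \<and> (\<forall>x\<in>M. \<forall>y\<in>M. x + y \<in> M) \<and> (\<forall>c. \<forall>x\<in>M. c *\<^sub>C x \<in> M)"

definition closed_cspan :: "'a::chilbert_space set \<Rightarrow> 'a set" where
  "closed_cspan S = (\<lambda>M. csubspace M \<and> closed M) hull S"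

definition clinear :: "('a::chilbert_space \<Rightarrow> 'a) \<Rightarrow> bool" where
  "clinear T \<longleftrightarrow> (\<forall>x y. T (x + y) = T x + T y) \<and> (\<forall>c x. T (c *\<^sub>C x) = c *\<^sub>C T x)"

definition bounded_clinear :: "('a::chilbert_space \<Rightarrow> 'a) \<Rightarrow> bool" where
  "bounded_clinear T \<longleftrightarrow> clinear T \<and> bounded_linear T"


section \<open>The lattice of orthogonal projections\<close>

definition orth_projection :: "('a::chilbert_space \<Rightarrow> 'a) \<Rightarrow> bool" where
  "orth_projection P \<longleftrightarrow>
     bounded_clinear P \<and> (\<forall>x. P (P x) = P x) \<and> (\<forall>x y. cinner (P x) y = cinner x (P y))"

definition proj_onto :: "'a::chilbert_space set \<Rightarrow> 'a \<Rightarrow> 'a" where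
  "proj_onto M = (THE P. orth_projection P \<and> range P = M)"

definition proj_Inf :: "('a::chilbert_space \<Rightarrow> 'a) set \<Rightarrow> 'a \<Rightarrow> 'a" where
  "proj_Inf \<P> = proj_onto (\<Inter>P\<in>\<P>. range P)"

definition proj_Sup :: "('a::chilbert_space \<Rightarrow> 'a) set \<Rightarrow> 'a \<Rightarrow> 'a" where
  "proj_Sup \<P> = proj_onto (closed_cspan (\<Union>P\<in>\<P>. range P))"

definition proj_inf :: "('a::chilbert_space \<Rightarrow> 'a) \<Rightarrow> ('a \<Rightarrow> 'a) \<Rightarrow> 'a \<Rightarrow> 'a"
    (infixl "\<sqinter>\<^sub>p" 70) where
  "P \<sqinter>\<^sub>p Q = proj_onto (range P \<inter> range Q)"

definition proj_sup :: "('a::chilbert_space \<Rightarrow> 'a) \<Rightarrow> ('a \<Rightarrow> 'a) \<Rightarrow> 'a \<Rightarrow> 'a"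
    (infixl "\<squnion>\<^sub>p" 65) where
  "P \<squnion>\<^sub>p Q = proj_onto (closed_cspan (range P \<union> range Q))"

definition proj_compl :: "('a::chilbert_space \<Rightarrow> 'a) \<Rightarrow> 'a \<Rightarrow> 'a" where
  "proj_compl P = (\<lambda>x. x - P x)"

definition proj_imp :: "('a::chilbert_space \<Rightarrow> 'a) \<Rightarrow> ('a \<Rightarrow> 'a) \<Rightarrow> 'a \<Rightarrow> 'a"
    (infixr "\<Rightarrow>\<^sub>p" 60) where
  "P \<Rightarrow>\<^sub>p Q = proj_compl P \<squnion>\<^sub>p (P \<sqinter>\<^sub>p Q)"


section \<open>Sets, and sets with values in the projection lattice\<close>

text \<open>
  HOL has no type of all sets of ZF. \<open>hcset\<close> is the type of hereditarily countable
  pure sets (equality of its elements is extensional), which contains every rational number.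
  Likewise \<open>'p qset\<close> consists of the hereditarily countable sets of pairs \<open>(u', p)\<close>, to be
  read as graphs of \<open>'p\<close>-valued functions on sets of the same kind; \<open>quniverse\<close> below
  singles out those that are hereditarily functions with orthogonal projections as values. The
  recursion for the truth values of \<open>u = v\<close> and \<open>u \<in> v\<close> inspects only the hereditary
  domains of \<open>u\<close> and \<open>v\<close>, so restricting the size of sets leaves these values unchanged.
\<close>

datatype hcset = HCSet (hcelts: "hcset cset")

definition hset :: "hcset set \<Rightarrow> hcset" where
  "hset S = HCSet (acset S)"

datatype 'p qset = QSet (qgraph_cset: "('p qset \<times> 'p) cset")

abbreviation qgraph :: "'p qset \<Rightarrow> ('p qset \<times> 'p) set" where
  "qgraph u \<equiv> rcset (qgraph_cset u)"

text \<open>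
  The transfinite hierarchy \<open>\<Union>\<alpha>. V\<^sub>\<alpha>\<close>, presented as the least class containing every
  projection-valued function all of whose arguments belong to the class.
\<close>

inductive_set quniverse :: "('a::chilbert_space \<Rightarrow> 'a) qset set" where
  "single_valued (qgraph u) \<Longrightarrow> (\<And>u' P. (u', P) \<in> qgraph u \<Longrightarrow> u' \<in> quniverse \<and> orth_projection P)
     \<Longrightarrow> u \<in> quniverse"

primrec check :: "hcset \<Rightarrow> ('a::chilbert_space \<Rightarrow> 'a) qset" where
  "check (HCSet S) = QSet (cimage (\<lambda>w. (w, id)) (cimage check S))"

definition qsub :: "('p qset \<times> 'p qset) set" where
  "qsub = {(u', u). \<exists>p. (u', p) \<in> qgraph u}"

lemma wf_qsub: "wf qsub"
proof (rule wfUNIVI)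
  fix P :: "'p qset \<Rightarrow> bool" and u
  assume IH: "\<forall>u. (\<forall>u'. (u', u) \<in> qsub \<longrightarrow> P u') \<longrightarrow> P u"
  show "P u"
  proof (induction u)
    case (QSet S)
    have "P u'" if sub: "(u', QSet S) \<in> qsub" for u'
    proof -
      from sub obtain p where "(u', p) \<in> rcset S"
        by (auto simp: qsub_def)
      then show ?thesis
        by (rule QSet) simp
    qed
    with IH show ?case by blast
  qed
qed

function qeq :: "('a::chilbert_space \<Rightarrow> 'a) qset \<Rightarrow> ('a \<Rightarrow> 'a) qset \<Rightarrow> 'a \<Rightarrow> 'a"
  and qmem :: "('a::chilbert_space \<Rightarrow> 'a) qset \<Rightarrow> ('a \<Rightarrow> 'a) qset \<Rightarrow> 'a \<Rightarrow> 'a" where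
  "qeq u v = proj_Inf ((\<lambda>(u', P). P \<Rightarrow>\<^sub>p qmem u' v) ` qgraph u)
             \<sqinter>\<^sub>p proj_Inf ((\<lambda>(v', Q). Q \<Rightarrow>\<^sub>p qmem v' u) ` qgraph v)"
| "qmem u v = proj_Sup ((\<lambda>(v', Q). Q \<sqinter>\<^sub>p qeq u v') ` qgraph v)"
  by pat_completeness auto

termination
proof -
  let ?m = "\<lambda>z. case z of Inl (u, v) \<Rightarrow> {#u, v#} | Inr (u, v) \<Rightarrow> {#u, v :: ('a \<Rightarrow> 'a) qset#}"
  have step: "({#u', v#}, {#u, v#}) \<in> mult qsub"
    if "(u', p) \<in> qgraph u" for u' u v :: "('a \<Rightarrow> 'a) qset" and p
    using one_step_implies_mult[of "{#u#}" "{#u'#}" qsub "{#v#}"] that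
    by (auto simp: qsub_def add_mset_commute)
  have step': "({#v, u'#}, {#u, v#}) \<in> mult qsub" "({#v, u'#}, {#v, u#}) \<in> mult qsub"
    "({#u', v#}, {#v, u#}) \<in> mult qsub"
    if "(u', p) \<in> qgraph u" for u' u v :: "('a \<Rightarrow> 'a) qset" and p
    using step[OF that, of v] by (simp_all add: add_mset_commute)
  show ?thesis
  proof (relation "inv_image (mult qsub) ?m")
    show "wf (inv_image (mult qsub) ?m)"
      by (intro wf_inv_image wf_mult wf_qsub)
  qed (auto intro: step step')
qed

declare qeq.simps [simp del] qmem.simps [simp del]


section \<open>The rational numbers as sets\<close>

text \<open>
  Von Neumann naturals and Kuratowski pairs; integers are classes of pairs of naturals with a given
  difference, rationals are classes of pairs of integers with a given quotient.
\<close>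

primrec nat_set :: "nat \<Rightarrow> hcset" where
  "nat_set 0 = hset {}"
| "nat_set (Suc n) = hset (insert (nat_set n) (rcset (hcelts (nat_set n))))"

definition kpair :: "hcset \<Rightarrow> hcset \<Rightarrow> hcset" where
  "kpair a b = hset {hset {a}, hset {a, b}}"

definition int_set :: "int \<Rightarrow> hcset" where
  "int_set z = hset {kpair (nat_set m) (nat_set n) | m n. int m - int n = z}"

definition rat_set :: "rat \<Rightarrow> hcset" where
  "rat_set r = hset {kpair (int_set a) (int_set b) | a b. b \<noteq> 0 \<and> of_int a / of_int b = r}"

lemma rcset_hset: "countable S \<Longrightarrow> rcset (hcelts (hset S)) = S"
  by (simp add: hset_def acset_inverse)

lemma hset_eq_iff: "countable S \<Longrightarrow> countable T \<Longrightarrow> hset S = hset T \<longleftrightarrow> S = T"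
  using rcset_hset by metis

lemma kpair_eq_iff: "kpair a b = kpair c d \<longleftrightarrow> a = c \<and> b = d"
  by (auto simp: kpair_def hset_eq_iff doubleton_eq_iff)

lemma hcelts_nat_set: "rcset (hcelts (nat_set n)) = nat_set ` {..<n}"
  by (induction n) (auto simp: rcset_hset lessThan_Suc)

definition hsub :: "(hcset \<times> hcset) set" where "hsub = {(u',u). u' \<in> rcset (hcelts u)}"

lemma wf_hsub: "wf hsub"
proof (rule wfUNIVI)
  fix P :: "hcset \<Rightarrow> bool" and u
  assume IH: "\<forall>u. (\<forall>u'. (u', u) \<in> hsub \<longrightarrow> P u') \<longrightarrow> P u"
  show "P u"
  proof (induction u)
    case (HCSet S)
    with IH show ?case by (auto simp: hsub_def)
  qed
qed

lemma nat_set_less: "m < n \<Longrightarrow> (nat_set m, nat_set n) \<in> hsub"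
  by (auto simp: hsub_def hcelts_nat_set)

lemma nat_set_eq_iff: "nat_set m = nat_set n \<longleftrightarrow> m = n"
  using nat_set_less wf_hsub by (metis nat_neq_iff wf_not_refl)

lemma int_set_eq_iff: "int_set y = int_set z \<longleftrightarrow> y = z"
proof
  have c: "countable {kpair (nat_set m) (nat_set n) |m n. int m - int n = z}" for z
    by (rule countable_subset[of _ "range (\<lambda>(m,n). kpair (nat_set m) (nat_set n))"]) auto
  assume "int_set y = int_set z"
  then have "{kpair (nat_set m) (nat_set n) |m n. int m - int n = y} = {kpair (nat_set m) (nat_set n) |m n. int m - int n = z}"
    by (simp add: int_set_def hset_eq_iff c)
  moreover have "kpair (nat_set (nat y)) (nat_set (nat (-y))) \<in> {kpair (nat_set m) (nat_set n) |m n. int m - int n = y}" by (intro CollectI exI[of _ "nat y"] exI[of _ "nat (-y)"]) auto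
  ultimately show "y = z" by (auto simp: kpair_eq_iff nat_set_eq_iff)
qed simp

lemma rat_set_eq_iff: "rat_set y = rat_set z \<longleftrightarrow> y = z"
proof
  have c: "countable {kpair (int_set a) (int_set b) |a b. b \<noteq> 0 \<and> of_int a / of_int b = (z::rat)}" for z
    by (rule countable_subset[of _ "range (\<lambda>(m,n). kpair (int_set m) (int_set n))"]) auto
  obtain a b where ab: "b \<noteq> 0" "y = of_int a / of_int b"
    by (metis Fract_of_int_quotient Rat_cases less_numeral_extra(3))
  assume "rat_set y = rat_set z"
  then have "{kpair (int_set a) (int_set b) |a b. b \<noteq> 0 \<and> of_int a / of_int b = y} = {kpair (int_set a) (int_set b) |a b. b \<noteq> 0 \<and> of_int a / of_int b = z}"
    by (simp add: rat_set_def hset_eq_iff c)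
  with ab have "kpair (int_set a) (int_set b) \<in> {kpair (int_set a) (int_set b) |a b. b \<noteq> 0 \<and> of_int a / of_int b = z}" by blast
  then show "y = z" by (auto simp: kpair_eq_iff int_set_eq_iff ab)
qed simp

lemma qgraph_check: "qgraph (check v) = (\<lambda>w. (check w, id)) ` rcset (hcelts v)"
  by (cases v) (auto simp: cimage.rep_eq)

lemma check_inj: "(check v::('a::chilbert_space\<Rightarrow>'a) qset) = check w \<Longrightarrow> v = w"
proof (induction v arbitrary: w)
  case (HCSet S)
  have *: "(\<lambda>w. (check w :: ('a\<Rightarrow>'a) qset, id::'a\<Rightarrow>'a)) ` rcset S = (\<lambda>w. (check w, id)) ` rcset (hcelts w)"
    using arg_cong[OF HCSet.prems, of "\<lambda>u. qgraph u"] unfolding qgraph_check hcset.sel .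
  have "x \<in> rcset (hcelts w)" if x: "x \<in> rcset S" for x
  proof -
    from x have "(check x :: ('a\<Rightarrow>'a) qset, id::'a\<Rightarrow>'a) \<in> (\<lambda>w. (check w :: ('a\<Rightarrow>'a) qset, id::'a\<Rightarrow>'a)) ` rcset (hcelts w)"
      unfolding *[symmetric] by (rule imageI)
    then obtain y where "y \<in> rcset (hcelts w)" "(check x::('a\<Rightarrow>'a) qset) = check y" by (elim imageE) simp
    with HCSet.IH[OF x] show ?thesis by simp
  qed
  moreover have "y \<in> rcset S" if y: "y \<in> rcset (hcelts w)" for y
  proof -
    from y have "(check y :: ('a\<Rightarrow>'a) qset, id::'a\<Rightarrow>'a) \<in> (\<lambda>w. (check w :: ('a\<Rightarrow>'a) qset, id::'a\<Rightarrow>'a)) ` rcset S"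
      unfolding * by (rule imageI)
    then obtain x where "x \<in> rcset S" "(check x::('a\<Rightarrow>'a) qset) = check y" by (elim imageE) simp
    with HCSet.IH[of x y] show ?thesis by simp
  qed
  ultimately have "rcset S = rcset (hcelts w)" by blast
  then show ?case by (cases w) (simp add: rcset_inject)
qed

lemma orth_projection_id: "orth_projection (id :: 'a::chilbert_space \<Rightarrow> 'a)"
  by (auto simp: orth_projection_def bounded_clinear_def clinear_def bounded_linear_ident id_def)

lemma check_in_quniverse: "check v \<in> quniverse"
proof (induction v)
  case (HCSet S)
  then show ?case by (intro quniverse.intros) (auto simp: qgraph_check single_valued_def orth_projection_id simp del: check.simps)
qed


section \<open>Self-adjoint operators and their resolutions of identity\<close>

text \<open>A possibly unbounded operator is given by its graph, so that its domain is \<^const>\<open>Domain\<close>.\<close>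

definition is_operator :: "('a::chilbert_space \<times> 'a) set \<Rightarrow> bool" where
  "is_operator A \<longleftrightarrow> single_valued A \<and> (0, 0) \<in> A \<and>
     (\<forall>(x, x')\<in>A. \<forall>(y, y')\<in>A. (x + y, x' + y') \<in> A) \<and>
     (\<forall>c. \<forall>(x, x')\<in>A. (c *\<^sub>C x, c *\<^sub>C x') \<in> A)"

definition adjoint_graph :: "('a::chilbert_space \<times> 'a) set \<Rightarrow> ('a \<times> 'a) set" where
  "adjoint_graph A = {(y, y'). \<forall>(x, x')\<in>A. cinner x' y = cinner x y'}"

definition self_adjoint :: "('a::chilbert_space \<times> 'a) set \<Rightarrow> bool" where
  "self_adjoint A \<longleftrightarrow> is_operator A \<and> closure (Domain A) = UNIV \<and> adjoint_graph A = A"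

text \<open>The Stieltjes measure \<open>d\<langle>x, E(\<lambda>) x\<rangle>\<close>.\<close>

definition spectral_measure :: "(real \<Rightarrow> 'a::chilbert_space \<Rightarrow> 'a) \<Rightarrow> 'a \<Rightarrow> real measure" where
  "spectral_measure E x = interval_measure (\<lambda>r. Re (cinner x (E r x)))"

definition resolution_of_identity :: "(real \<Rightarrow> 'a::chilbert_space \<Rightarrow> 'a) \<Rightarrow> bool" where
  "resolution_of_identity E \<longleftrightarrow>
     (\<forall>r. orth_projection (E r)) \<and>
     (\<forall>r s. r \<le> s \<longrightarrow> range (E r) \<subseteq> range (E s)) \<and>
     (\<forall>x s. ((\<lambda>r. E r x) \<longlongrightarrow> E s x) (at_right s)) \<and>
     (\<forall>x. ((\<lambda>r. E r x) \<longlongrightarrow> 0) at_bot) \<and>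
     (\<forall>x. ((\<lambda>r. E r x) \<longlongrightarrow> x) at_top)"

text \<open>
  \<open>E\<close> is the resolution of identity of \<open>A\<close>, i.e. \<open>A = \<integral> \<lambda> dE(\<lambda>)\<close>. The integral is
  expressed by its quadratic form, which by polarization determines the operator.
\<close>

definition resolution_of :: "('a::chilbert_space \<times> 'a) set \<Rightarrow> (real \<Rightarrow> 'a \<Rightarrow> 'a) \<Rightarrow> bool" where
  "resolution_of A E \<longleftrightarrow> resolution_of_identity E \<and>
     Domain A = {x. integrable (spectral_measure E x) (\<lambda>t. t\<^sup>2)} \<and>
     (\<forall>(x, y)\<in>A. cinner x y = complex_of_real (\<integral>t. t \<partial>spectral_measure E x))"

text \<open>\<open>\<integral> f(\<lambda>) dE(\<lambda>)\<close> for bounded Borel \<open>f\<close>, again through its quadratic form.\<close>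

definition fcalc :: "(real \<Rightarrow> 'a::chilbert_space \<Rightarrow> 'a) \<Rightarrow> (real \<Rightarrow> complex) \<Rightarrow> 'a \<Rightarrow> 'a" where
  "fcalc E f =
     (THE T. bounded_clinear T \<and> (\<forall>x. cinner x (T x) = (\<integral>t. f t \<partial>spectral_measure E x)))"

definition spectral_proj :: "(real \<Rightarrow> 'a::chilbert_space \<Rightarrow> 'a) \<Rightarrow> real set \<Rightarrow> 'a \<Rightarrow> 'a" where
  "spectral_proj E \<Delta> = fcalc E (indicator \<Delta>)"

text \<open>The element of the universe that represents the operator with resolution of identity \<open>E\<close>.\<close>

definition qreal :: "(real \<Rightarrow> 'a::chilbert_space \<Rightarrow> 'a) \<Rightarrow> ('a \<Rightarrow> 'a) qset" where
  "qreal E = QSet (acset (range (\<lambda>r. (check (rat_set r), E (real_of_rat r)))))"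

lemma qgraph_qreal: "qgraph (qreal E) = range (\<lambda>r. (check (rat_set r), E (of_rat r)))"
  by (simp add: qreal_def acset_inverse)

lemma qreal_in_quniverse:
  fixes E :: "real \<Rightarrow> 'a::chilbert_space \<Rightarrow> 'a"
  assumes r: "resolution_of_identity E"
  shows "qreal E \<in> quniverse"
proof (rule quniverse.intros)
  show "single_valued (qgraph (qreal E))"
  proof (rule single_valuedI)
    fix x y z assume "(x,y) \<in> qgraph (qreal E)" "(x,z) \<in> qgraph (qreal E)"
    then obtain q s where qs: "x = check (rat_set q)" "y = E (of_rat q)" "x = check (rat_set s)" "z = E (of_rat s)"
      unfolding qgraph_qreal by blast
    from qs(3) have "check (rat_set q) = (check (rat_set s) :: ('a \<Rightarrow> 'a) qset)"
      unfolding qs(1) .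
    then have "q = s"
      using check_inj rat_set_eq_iff by blast
    with qs show "y = z" by simp
  qed
  fix u' P assume "(u', P) \<in> qgraph (qreal E)"
  then obtain q where "u' = check (rat_set q)" "P = E (of_rat q)" unfolding qgraph_qreal by blast
  then show "u' \<in> quniverse \<and> orth_projection P" using r check_in_quniverse unfolding resolution_of_identity_def by blast
qed

definition joint_distribution ::
  "(real \<Rightarrow> 'a::chilbert_space \<Rightarrow> 'a) \<Rightarrow> (real \<Rightarrow> 'a \<Rightarrow> 'a) \<Rightarrow> 'a \<Rightarrow> (real \<times> real) measure \<Rightarrow> bool"
  where
  "joint_distribution E F \<psi> \<mu> \<longleftrightarrow> prob_space \<mu> \<and> sets \<mu> = sets borel \<and>
     (\<forall>\<Delta>\<in>sets borel. \<forall>\<Gamma>\<in>sets borel.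
        complex_of_real (measure \<mu> (\<Delta> \<times> \<Gamma>))
          = cinner \<psi> ((spectral_proj E \<Delta> \<sqinter>\<^sub>p spectral_proj F \<Gamma>) \<psi>))"

end

theory Submission
  imports Defs "HOL-Probability.Distribution_Functions"
begin

text \<open>
  Truth values of equations between check sets are \<open>1\<close> or \<open>0\<close>, so
  \<open>\<lbrakk>r \<in> A\<rbrakk> = E\<^sup>A(r)\<close> and
  \<open>\<lbrakk>A = B\<rbrakk>\<close> is the meet over all rational \<open>r\<close> of the two implications between
  \<open>E\<^sup>A(r)\<close> and \<open>E\<^sup>B(r)\<close>. The range of \<open>P \<Rightarrow> Q\<close> consists of the vectors that \<open>P\<close> maps into the
  range of \<open>Q\<close>; a vector in both \<open>P \<Rightarrow> Q\<close> and \<open>Q \<Rightarrow> P\<close> is therefore mapped by \<open>P\<close> and by \<open>Q\<close> to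
  its projection to the meet, which gives (i) \<open>\<longleftrightarrow>\<close> (ii). Right continuity extends (ii) to all real
  \<open>r\<close>, a \<open>\<pi>\<close>-\<open>\<lambda>\<close> argument to spectral projections of Borel sets, and uniform approximation by simple
  functions to (iii). If (iii) holds, multiplicativity of the spectral projections gives (iv) and
  shows that \<open>E\<^sup>A(\<Delta>) \<and> E\<^sup>B(\<Gamma>)\<close> maps \<open>\<psi>\<close> to \<open>E\<^sup>A(\<Delta> \<inter> \<Gamma>)\<psi>\<close>; the image of the spectral measure
  under \<open>t \<mapsto> (t, t)\<close> is then the distribution required in (v). Conversely, half-lines suffice
  to recover (ii) from (iv) or (v).

  No Riesz representation is needed to construct the functional calculus: spectral projections of
  Borel sets are built directly by the \<open>\<pi>\<close>-\<open>\<lambda>\<close> theorem, since projections onto disjoint Borel sets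
  are automatically orthogonal.
\<close>

section \<open>Complex inner products\<close>

lemma cinner_add_left: "cinner (x + y) z = cinner x z + cinner y z"
  by (metis cinner_add_right cinner_commute complex_cnj_add)

lemma cinner_scaleC_left: "cinner (c *\<^sub>C x) y = cnj c * cinner x y"
  by (metis cinner_scaleC_right cinner_commute complex_cnj_mult)

lemma cinner_scaleR_right: "cinner x (r *\<^sub>R y) = r *\<^sub>R cinner x y"
  by (metis cinner_scaleC_right scaleC_of_real scaleR_conv_of_real)

lemma cinner_scaleR_left: "cinner (r *\<^sub>R x) y = r *\<^sub>R cinner x y"
  by (metis cinner_scaleC_left scaleC_of_real scaleR_conv_of_real complex_cnj_complex_of_real)

lemma cinner_self: "cinner x x = complex_of_real ((norm x)\<^sup>2)"
proof (rule complex_eqI)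
  have "Im (cinner x x) = - Im (cinner x x)"
    by (subst (1) cinner_commute) simp
  then show "Im (cinner x x) = Im (complex_of_real ((norm x)\<^sup>2))"
    unfolding Im_complex_of_real by linarith
qed (simp add: Re_cinner dot_square_norm)

lemma norm_scaleC: "norm (c *\<^sub>C x) = cmod c * norm x" for x :: "'a::chilbert_space"
proof -
  have "complex_of_real ((norm (c *\<^sub>C x))\<^sup>2) = (c * cnj c) * cinner x x"
    by (simp only: cinner_self[symmetric] cinner_scaleC_left cinner_scaleC_right mult_ac)
  also have "\<dots> = complex_of_real ((cmod c * norm x)\<^sup>2)"
    by (simp only: cinner_self complex_norm_square[symmetric] power_mult_distrib of_real_mult)
  finally have "complex_of_real ((norm (c *\<^sub>C x))\<^sup>2) = complex_of_real ((cmod c * norm x)\<^sup>2)" .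
  then have "(norm (c *\<^sub>C x))\<^sup>2 = (cmod c * norm x)\<^sup>2"
    using of_real_eq_iff by blast
  then show ?thesis by (simp add: power2_eq_iff_nonneg)
qed

text \<open>The real Cauchy-Schwarz inequality suffices: a unimodular factor \<open>c\<close> on the
  second argument turns the complex inner product into its modulus.\<close>

lemma cmod_cinner_le: "cmod (cinner x y) \<le> norm x * norm y"
proof (cases "cinner x y = 0")
  case False
  define c where "c = cnj (cinner x y) / cmod (cinner x y)"
  have c: "cmod c = 1" using False by (simp add: c_def norm_divide)
  have "complex_of_real (cmod (cinner x y)) = cinner x (c *\<^sub>C y)"
    using False
    by (simp add: cinner_scaleC_right c_def complex_norm_square[symmetric] mult.commute power2_eq_square divide_simps)
  then have "cmod (cinner x y) = inner x (c *\<^sub>C y)"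
    by (metis Re_cinner Re_complex_of_real)
  also have "\<dots> \<le> norm x * norm (c *\<^sub>C y)" by (rule norm_cauchy_schwarz)
  finally show ?thesis by (simp add: norm_scaleC c)
qed auto

lemma bounded_bilinear_cinner: "bounded_bilinear (cinner :: 'a::chilbert_space \<Rightarrow> _)"
  by standard (auto simp: cinner_add_left cinner_add_right cinner_scaleR_left cinner_scaleR_right
      intro!: exI[of _ 1] cmod_cinner_le)

interpretation cinner: bounded_bilinear "cinner :: 'a::chilbert_space \<Rightarrow> 'a \<Rightarrow> complex"
  by (rule bounded_bilinear_cinner)

declare cinner.zero_left [simp] cinner.zero_right [simp]

lemma cinner_eq_0_commute: "cinner x y = 0 \<longleftrightarrow> cinner y x = 0"
  by (metis cinner_commute complex_cnj_zero)

lemma cinner_ext: "(\<And>z. cinner z x = cinner z y) \<Longrightarrow> x = y"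
  using cinner_self[of "x - y"] by (simp add: cinner.diff_right)

lemma scaleC_zero_right [simp]: "c *\<^sub>C 0 = (0::'a::chilbert_space)"
  using norm_scaleC[of c "0::'a"] by simp

lemma scaleC_minus_one: "(- 1) *\<^sub>C x = - x" for x :: "'a::chilbert_space"
  using scaleC_of_real[of "- 1" x] by simp

lemma scaleC_diff_right: "c *\<^sub>C (x - y) = c *\<^sub>C x - c *\<^sub>C y" for x :: "'a::chilbert_space"
  using scaleC_add_right[of c "x - y" y] by (simp add: algebra_simps)

lemma bounded_linear_scaleC: "bounded_linear ((*\<^sub>C) c :: 'a::chilbert_space \<Rightarrow> 'a)"
proof (rule bounded_linear_intro[where K = "cmod c"])
  fix r :: real and x :: 'a
  show "c *\<^sub>C (r *\<^sub>R x) = r *\<^sub>R (c *\<^sub>C x)"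
    unfolding scaleC_of_real[symmetric] scaleC_scaleC by (simp add: mult.commute)
qed (simp_all add: scaleC_add_right norm_scaleC mult.commute)

lemma csubspace_minus: "csubspace M \<Longrightarrow> x \<in> M \<Longrightarrow> - x \<in> M"
  unfolding csubspace_def by (metis scaleC_minus_one)

lemma csubspace_diff: "csubspace M \<Longrightarrow> x \<in> M \<Longrightarrow> y \<in> M \<Longrightarrow> x - y \<in> M"
  using csubspace_minus[of M y] unfolding csubspace_def by (metis uminus_add_conv_diff add.commute)

lemma csubspace_scaleR: "csubspace M \<Longrightarrow> x \<in> M \<Longrightarrow> r *\<^sub>R x \<in> M"
  unfolding csubspace_def by (metis scaleC_of_real)

lemma csubspace_imp_subspace: "csubspace M \<Longrightarrow> subspace M"
  unfolding subspace_def using csubspace_scaleR by (auto simp: csubspace_def)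

lemma clinear_imp_linear: "clinear T \<Longrightarrow> linear T"
  by (rule linearI) (auto simp: clinear_def simp flip: scaleC_of_real)

lemma bounded_clinearI:
  assumes "clinear T" "\<And>x. norm (T x) \<le> C * norm x"
  shows "bounded_clinear T"
  using clinear_imp_linear[OF assms(1)] assms
  by (auto simp: bounded_clinear_def bounded_linear_def bounded_linear_axioms_def mult.commute intro!: exI[of _ C])

lemma bounded_clinear_diff:
  "bounded_clinear S \<Longrightarrow> bounded_clinear T \<Longrightarrow> bounded_clinear (\<lambda>x. S x - T x)"
  by (auto simp: bounded_clinear_def clinear_def scaleC_diff_right intro: bounded_linear_sub)

lemma bounded_clinear_add:
  "bounded_clinear S \<Longrightarrow> bounded_clinear T \<Longrightarrow> bounded_clinear (\<lambda>x. S x + T x)"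
  by (auto simp: bounded_clinear_def clinear_def scaleC_add_right intro: bounded_linear_add)

lemma bounded_clinear_scaleC: "bounded_clinear T \<Longrightarrow> bounded_clinear (\<lambda>x. c *\<^sub>C T x)"
  by (auto simp: bounded_clinear_def clinear_def scaleC_add_right scaleC_scaleC mult.commute
      intro: bounded_linear_compose[OF bounded_linear_scaleC])

section \<open>Polarization and bounds from quadratic forms\<close>

text \<open>Makes an operator recoverable from its quadratic form, which is how the functional
  calculus is specified. The signs of the imaginary terms reflect antilinearity in the first
  argument.\<close>

lemma polarization:
  fixes T :: "'a::chilbert_space \<Rightarrow> 'a"
  assumes "clinear T"
  defines "q \<equiv> \<lambda>z. cinner z (T z)"
  shows "4 * cinner x (T y) =
    q (x + y) - q (x - y) - \<i> * q (x + \<i> *\<^sub>C y) + \<i> * q (x - \<i> *\<^sub>C y)"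
proof -
  interpret linear T by (rule clinear_imp_linear) fact
  have [simp]: "T (c *\<^sub>C x) = c *\<^sub>C T x" for c x using assms by (simp add: clinear_def)
  show ?thesis
    by (simp add: q_def add diff cinner_add_left cinner_add_right cinner.diff_left cinner.diff_right
        cinner_scaleC_left cinner_scaleC_right algebra_simps)
qed

lemma clinear_eqI_quadratic:
  fixes S T :: "'a::chilbert_space \<Rightarrow> 'a"
  assumes "clinear S" "clinear T" "\<And>x. cinner x (S x) = cinner x (T x)"
  shows "S = T"
proof (intro ext cinner_ext)
  fix x z
  have "4 * cinner z (S x) = 4 * cinner z (T x)"
    unfolding polarization[OF assms(1)] polarization[OF assms(2)] assms(3) ..
  then show "cinner z (S x) = cinner z (T x)" by simp
qed

text \<open>Polarization and the parallelogram law bound the sesquilinear form; testing it against a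
  multiple of \<open>T y\<close> bounds the norm. The factor 2 is the general price of passing from
  the numerical radius to the norm.\<close>

lemma norm_le_of_quadratic:
  fixes T :: "'a::chilbert_space \<Rightarrow> 'a"
  assumes T: "clinear T" and q: "\<And>x. cmod (cinner x (T x)) \<le> e * (norm x)\<^sup>2"
  shows "norm (T y) \<le> 2 * e * norm y"
proof -
  have par: "(norm (a + b))\<^sup>2 + (norm (a - b))\<^sup>2 = 2 * (norm a)\<^sup>2 + 2 * (norm b)\<^sup>2" for a b :: 'a
    by (simp add: power2_norm_eq_inner inner_add inner_diff inner_commute)
  have form: "cmod (cinner x (T y)) \<le> e * ((norm x)\<^sup>2 + (norm y)\<^sup>2)" for x y
  proof -
    have "4 * cmod (cinner x (T y)) = cmod (4 * cinner x (T y))" by (simp add: norm_mult)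
    also have "\<dots> \<le> e * (norm (x + y))\<^sup>2 + e * (norm (x - y))\<^sup>2
        + e * (norm (x + \<i> *\<^sub>C y))\<^sup>2 + e * (norm (x - \<i> *\<^sub>C y))\<^sup>2"
      unfolding polarization[OF T]
      by (intro norm_triangle_le norm_triangle_le_diff add_mono) (auto simp: norm_mult q)
    also have "\<dots> = e * ((norm (x + y))\<^sup>2 + (norm (x - y))\<^sup>2)
        + e * ((norm (x + \<i> *\<^sub>C y))\<^sup>2 + (norm (x - \<i> *\<^sub>C y))\<^sup>2)"
      by (simp add: algebra_simps)
    also have "\<dots> = 4 * (e * ((norm x)\<^sup>2 + (norm y)\<^sup>2))"
      unfolding par by (simp add: norm_scaleC algebra_simps)
    finally show ?thesis by simp
  qed
  show ?thesis
  proof (cases "T y = 0 \<or> y = 0")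
    case True
    have "0 \<le> e * (norm y)\<^sup>2" using q[of y] norm_ge_zero order_trans by blast
    then have "0 \<le> 2 * e * norm y" by (auto simp: zero_le_mult_iff)
    moreover have "T 0 = 0" using clinear_imp_linear[OF T] by (rule linear_0)
    ultimately show ?thesis using True by auto
  next
    case False
    \<comment> \<open>\<open>T y\<close> rescaled to the length of \<open>y\<close>, so that a
      factor \<open>norm y\<close> cancels at the end.\<close>
    define x where "x = (norm y / norm (T y)) *\<^sub>R T y"
    have "cinner x (T y) = complex_of_real (norm y * norm (T y))"
      using False by (simp add: x_def cinner_scaleR_left cinner_self scaleR_conv_of_real power2_eq_square)
    moreover have "norm x = norm y" using False by (simp add: x_def)
    ultimately have "norm y * norm (T y) \<le> norm y * (2 * e * norm y)"
      using form[of x y] by (simp add: norm_mult power2_eq_square algebra_simps)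
    then show ?thesis using False by simp
  qed
qed

section \<open>The projection theorem and the projection lattice\<close>

lemma orth_projection_bounded_clinear: "orth_projection P \<Longrightarrow> bounded_clinear P"
  and orth_projection_idem: "orth_projection P \<Longrightarrow> P (P x) = P x"
  and orth_projection_adjoint: "orth_projection P \<Longrightarrow> cinner (P x) y = cinner x (P y)"
  by (auto simp: orth_projection_def)

lemma orth_projection_clinear: "orth_projection P \<Longrightarrow> clinear P"
  and orth_projection_bounded_linear: "orth_projection P \<Longrightarrow> bounded_linear P"
  by (auto simp: orth_projection_def bounded_clinear_def)

lemma orth_projection_zero: "orth_projection P \<Longrightarrow> P 0 = 0"
  and orth_projection_add: "orth_projection P \<Longrightarrow> P (x + y) = P x + P y"
  and orth_projection_diff: "orth_projection P \<Longrightarrow> P (x - y) = P x - P y"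
  using orth_projection_bounded_linear[of P]
  by (simp_all add: bounded_linear.linear linear_0 linear_add linear_diff)

lemma orth_projection_range_iff: "orth_projection P \<Longrightarrow> x \<in> range P \<longleftrightarrow> P x = x"
  by (metis orth_projection_idem rangeE rangeI)

lemma orth_projection_quadratic: "orth_projection P \<Longrightarrow> cinner x (P x) = complex_of_real ((norm (P x))\<^sup>2)"
  by (metis cinner_self orth_projection_adjoint orth_projection_idem)

text \<open>Pythagoras, in the form that later turns equality of norms into
  \<open>P x = x\<close>.\<close>

lemma orth_projection_norm_diff:
  assumes "orth_projection P"
  shows "(norm (x - P x))\<^sup>2 = (norm x)\<^sup>2 - (norm (P x))\<^sup>2"
proof -
  have "cinner (x - P x) (x - P x) = cinner x x - cinner x (P x)"
    using assms
    by (simp add: cinner.diff_left cinner.diff_right orth_projection_adjoint orth_projection_idem)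
  then have "complex_of_real ((norm (x - P x))\<^sup>2) = complex_of_real ((norm x)\<^sup>2 - (norm (P x))\<^sup>2)"
    by (simp only: cinner_self orth_projection_quadratic[OF assms] of_real_diff)
  then show ?thesis using of_real_eq_iff by blast
qed

lemma orth_projection_norm_le: "orth_projection P \<Longrightarrow> norm (P x) \<le> norm x"
  using orth_projection_norm_diff[of P x] by (smt (verit) norm_ge_zero power2_le_imp_le zero_le_power2)

text \<open>Boundedness is automatic: by idempotence and symmetry the square of
  \<open>norm (P x)\<close> is \<open>cinner x (P x)\<close>, and Cauchy-Schwarz bounds this by
  \<open>norm x * norm (P x)\<close>.\<close>

lemma orth_projectionI:
  assumes "clinear P" "\<And>x. P (P x) = P x" "\<And>x y. cinner (P x) y = cinner x (P y)"
  shows "orth_projection P"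
proof -
  have "norm (P x) \<le> 1 * norm x" for x
  proof (cases "P x = 0")
    case False
    have "cinner x (P x) = cinner (P x) (P x)" by (simp add: assms)
    then have "norm (P x) * norm (P x) = cmod (cinner x (P x))"
      by (simp add: cinner_self norm_power power2_eq_square norm_mult)
    also have "\<dots> \<le> norm x * norm (P x)" by (rule cmod_cinner_le)
    finally show ?thesis using False by simp
  qed simp
  then show ?thesis
    using assms bounded_clinearI[of P 1] by (auto simp: orth_projection_def)
qed

lemma csubspace_range:
  assumes "orth_projection P" shows "csubspace (range P)"
  using orth_projection_clinear[OF assms] orth_projection_zero[OF assms] orth_projection_idem[OF assms]
  unfolding csubspace_def orth_projection_range_iff[OF assms] by (auto simp: clinear_def)

lemma closed_range:
  assumes "orth_projection P" shows "closed (range P)"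
proof -
  have "range P = {x. P x = x}" using orth_projection_range_iff[OF assms] by auto
  then show ?thesis
    using bounded_linear.continuous_on[OF orth_projection_bounded_linear[OF assms] continuous_on_id]
    by (simp add: closed_Collect_eq continuous_on_id)
qed

text \<open>
  The distance from \<open>x\<close> to \<open>M\<close> is attained: by the parallelogram law a minimizing sequence is
  Cauchy.
\<close>

lemma nearest_point_exists:
  fixes M :: "'a::{real_inner, complete_space} set"
  assumes M: "subspace M" "closed M"
  obtains m where "m \<in> M" "\<And>w. w \<in> M \<Longrightarrow> norm (x - m) \<le> norm (x - w)"
proof -
  define d where "d = (INF w\<in>M. norm (x - w))"
  have bdd: "bdd_below ((\<lambda>w. norm (x - w)) ` M)" by (rule bdd_belowI[of _ 0]) auto
  have M0: "0 \<in> M" by (rule subspace_0) fact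
  have d_le: "d \<le> norm (x - w)" if "w \<in> M" for w
    unfolding d_def using bdd that by (rule cINF_lower)
  have d0: "0 \<le> d" unfolding d_def using M0 by (intro cINF_greatest) auto
  have "\<exists>w\<in>M. norm (x - w) < d + 1 / Suc n" for n
  proof -
    have "d < d + 1 / Suc n" by simp
    then show ?thesis unfolding d_def using bdd M0 by (subst (asm) cINF_less_iff) auto
  qed
  then obtain u where u: "\<And>n. u n \<in> M" "\<And>n. norm (x - u n) < d + 1 / Suc n"
    by metis
  have lim: "(\<lambda>n. d + 1 / Suc n) \<longlonglongrightarrow> d"
    using LIMSEQ_inverse_real_of_nat_add[of d] by (simp only: inverse_eq_divide)
  have u_lim: "(\<lambda>n. norm (x - u n)) \<longlonglongrightarrow> d"
    by (rule tendsto_sandwich[OF always_eventually always_eventually tendsto_const lim])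
      (simp_all only: d_le u(1) less_imp_le[OF u(2)] simp_thms)
  \<comment> \<open>The parallelogram law for \<open>x - u m\<close> and \<open>x - u n\<close>; the
    midpoint of \<open>u m\<close> and \<open>u n\<close> lies in \<open>M\<close>, hence at
    distance at least \<open>d\<close> from \<open>x\<close>.\<close>
  have par: "(norm (u m - u n))\<^sup>2 \<le> 2 * ((norm (x - u m))\<^sup>2 - d\<^sup>2) + 2 * ((norm (x - u n))\<^sup>2 - d\<^sup>2)" for m n
  proof -
    have "(1/2) *\<^sub>R (u m + u n) \<in> M" using M(1) u(1) by (intro subspace_scale subspace_add)
    then have "d\<^sup>2 \<le> (norm (x - (1/2) *\<^sub>R (u m + u n)))\<^sup>2"
      using d_le d0 by (intro power_mono) auto
    moreover have "(norm (u m - u n))\<^sup>2 + 4 * (norm (x - (1/2) *\<^sub>R (u m + u n)))\<^sup>2 =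
        2 * (norm (x - u m))\<^sup>2 + 2 * (norm (x - u n))\<^sup>2"
      by (simp add: power2_norm_eq_inner inner_add inner_diff inner_commute algebra_simps)
    ultimately show ?thesis by simp
  qed
  have "Cauchy u"
  proof (rule CauchyI)
    fix e :: real assume e: "0 < e"
    have "(\<lambda>n. 2 * ((norm (x - u n))\<^sup>2 - d\<^sup>2)) \<longlonglongrightarrow> 2 * (d\<^sup>2 - d\<^sup>2)"
      by (intro tendsto_intros u_lim)
    then have "eventually (\<lambda>n. 2 * ((norm (x - u n))\<^sup>2 - d\<^sup>2) < e\<^sup>2 / 2) sequentially"
      using e by (intro order_tendstoD) auto
    then obtain N where N: "\<And>n. n \<ge> N \<Longrightarrow> 2 * ((norm (x - u n))\<^sup>2 - d\<^sup>2) < e\<^sup>2 / 2"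
      by (auto simp: eventually_sequentially)
    have "norm (u m - u n) < e" if "m \<ge> N" "n \<ge> N" for m n
    proof -
      have "(norm (u m - u n))\<^sup>2 < e\<^sup>2" using par[of m n] N[OF that(1)] N[OF that(2)] by linarith
      then show ?thesis using e by (simp add: power2_less_imp_less)
    qed
    then show "\<exists>N. \<forall>m\<ge>N. \<forall>n\<ge>N. norm (u m - u n) < e" by blast
  qed
  then obtain l where l: "u \<longlonglongrightarrow> l" using Cauchy_convergent convergent_def by blast
  then have "l \<in> M" using M(2) u(1) closed_sequentially by blast
  moreover have "norm (x - l) = d"
    by (rule LIMSEQ_unique[OF _ u_lim]) (intro tendsto_intros l)
  ultimately show thesis using d_le that by metis
qed

text \<open>Moving the nearest point along \<open>w\<close> cannot shorten the distance, which
  forces the real inner product to vanish; the same argument for \<open>\<i> *\<^sub>C w\<close>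
  handles the imaginary part.\<close>

lemma orthogonal_decomposition:
  fixes M :: "'a::chilbert_space set"
  assumes M: "csubspace M" "closed M"
  obtains m where "m \<in> M" "\<And>w. w \<in> M \<Longrightarrow> cinner w (x - m) = 0"
proof -
  obtain m where m: "m \<in> M" and min: "\<And>w. w \<in> M \<Longrightarrow> norm (x - m) \<le> norm (x - w)"
    using nearest_point_exists[OF csubspace_imp_subspace[OF M(1)] M(2)] by blast
  have in0: "inner w (x - m) = 0" if w: "w \<in> M" for w
  proof -
    define s where "s = inner w (x - m)"
    \<comment> \<open>The minimizing step would be \<open>s / (norm w)\<^sup>2\<close>; the added 1
      avoids division by zero and still yields \<open>s = 0\<close>.\<close>
    define t where "t = s / ((norm w)\<^sup>2 + 1)"
    have "m + t *\<^sub>R w \<in> M" using M(1) m w csubspace_scaleR unfolding csubspace_def by blast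
    then have "(norm (x - m))\<^sup>2 \<le> (norm ((x - m) - t *\<^sub>R w))\<^sup>2"
      using min[of "m + t *\<^sub>R w"] by (intro power_mono) (auto simp: algebra_simps)
    also have "\<dots> = (norm (x - m))\<^sup>2 - 2 * t * s + t\<^sup>2 * (norm w)\<^sup>2"
      unfolding s_def power2_norm_eq_inner
      by (simp add: inner_diff inner_commute algebra_simps power2_eq_square)
    finally have "2 * t * s \<le> t\<^sup>2 * (norm w)\<^sup>2" by simp
    also have "\<dots> \<le> t\<^sup>2 * ((norm w)\<^sup>2 + 1)" by (intro mult_left_mono) auto
    also have "\<dots> = t * s"
      unfolding t_def power2_eq_square using not_sum_power2_lt_zero[of "norm w" 1]
      by (simp add: divide_simps)
    finally have "t * s \<le> 0" by (simp add: mult.commute)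
    moreover have "t * s = s\<^sup>2 / ((norm w)\<^sup>2 + 1)" by (simp add: t_def power2_eq_square)
    moreover have "(norm w)\<^sup>2 + 1 > 0" by (simp add: add_nonneg_pos)
    ultimately have "s = 0" by (simp add: divide_le_0_iff)
    then show ?thesis by (simp add: s_def)
  qed
  have "cinner w (x - m) = 0" if w: "w \<in> M" for w
  proof (rule complex_eqI)
    show "Re (cinner w (x - m)) = Re 0" using in0[OF w] by (simp add: Re_cinner)
    have "\<i> *\<^sub>C w \<in> M" using M(1) w by (simp add: csubspace_def)
    from in0[OF this] have "Re (cinner (\<i> *\<^sub>C w) (x - m)) = 0" by (simp add: Re_cinner)
    then show "Im (cinner w (x - m)) = Im 0" by (simp add: cinner_scaleC_left)
  qed
  with m show thesis using that by blast
qed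

text \<open>The difference of two candidates lies in \<open>M\<close> and is orthogonal to itself.
  This is the standard device below for identifying values of projections.\<close>

lemma orthogonal_decomposition_unique:
  fixes M :: "'a::chilbert_space set"
  assumes M: "csubspace M" and m: "m \<in> M" "\<And>w. w \<in> M \<Longrightarrow> cinner w (x - m) = 0"
    and n: "n \<in> M" "\<And>w. w \<in> M \<Longrightarrow> cinner w (x - n) = 0"
  shows "m = n"
proof -
  have d: "m - n \<in> M" by (rule csubspace_diff) fact+
  have "cinner (m - n) (m - n) = cinner (m - n) (x - n) - cinner (m - n) (x - m)"
    by (simp add: cinner.diff_right)
  also have "\<dots> = 0" using m(2)[OF d] n(2)[OF d] by simp
  finally show ?thesis by (simp add: cinner_self)
qed

lemma orth_projection_orthogonal:
  assumes "orth_projection P" "w \<in> range P" shows "cinner w (x - P x) = 0"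
  using assms by (auto simp: orth_projection_adjoint orth_projection_diff orth_projection_idem)

lemma orth_projection_exists:
  fixes M :: "'a::chilbert_space set"
  assumes M: "csubspace M" "closed M"
  obtains P where "orth_projection P" "range P = M"
proof -
  have "\<exists>m. m \<in> M \<and> (\<forall>w\<in>M. cinner w (x - m) = 0)" for x
    by (rule orthogonal_decomposition[OF M, of x]) blast
  then obtain P where "\<forall>x. P x \<in> M \<and> (\<forall>w\<in>M. cinner w (x - P x) = 0)"
    using choice[of "\<lambda>x m. m \<in> M \<and> (\<forall>w\<in>M. cinner w (x - m) = 0)"] by blast
  then have P: "\<And>x. P x \<in> M" "\<And>x w. w \<in> M \<Longrightarrow> cinner w (x - P x) = 0"
    by blast+
  \<comment> \<open>Reduces linearity and idempotence of \<open>P\<close> to checking that a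
    candidate value lies in \<open>M\<close> with residual orthogonal to \<open>M\<close>.\<close>
  have eqI: "P x = m" if "m \<in> M" "\<And>w. w \<in> M \<Longrightarrow> cinner w (x - m) = 0" for x m
    using orthogonal_decomposition_unique[OF M(1) P that] by simp
  have fixed: "P m = m" if "m \<in> M" for m by (rule eqI) (use that in auto)
  have "orth_projection P"
  proof (rule orth_projectionI)
    show "clinear P"
      unfolding clinear_def
    proof safe
      fix x y
      have "cinner w (x + y - (P x + P y)) = 0" if "w \<in> M" for w
        using P(2)[OF that, of x] P(2)[OF that, of y]
        by (simp add: cinner.diff_right cinner.add_right algebra_simps)
      then show "P (x + y) = P x + P y"
        using M(1) P(1) by (intro eqI) (auto simp: csubspace_def)
    next
      fix c x
      have "cinner w (c *\<^sub>C x - c *\<^sub>C P x) = 0" if "w \<in> M" for w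
        using P(2)[OF that, of x] by (simp add: cinner_scaleC_right flip: scaleC_diff_right)
      then show "P (c *\<^sub>C x) = c *\<^sub>C P x"
        using M(1) P(1) by (intro eqI) (auto simp: csubspace_def)
    qed
    show "P (P x) = P x" for x by (rule fixed) (rule P)
    show "cinner (P x) y = cinner x (P y)" for x y
    proof -
      have "cinner (P x) (y - P y) = 0" "cinner (P y) (x - P x) = 0" by (intro P)+
      then have "cinner (P x) (P y) = cinner (P x) y" "cinner (x - P x) (P y) = 0"
        by (simp_all add: cinner.diff_right cinner_eq_0_commute[of "x - P x"])
      then show ?thesis by (simp add: cinner.diff_left)
    qed
  qed
  moreover have "range P = M" using P(1) fixed by (metis image_subset_iff rangeI subsetI subset_antisym)
  ultimately show thesis by (rule that)
qed

section \<open>Projections determined by ranges, and the lattice operations\<close>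

text \<open>Both values are the foot of \<open>x\<close> in the common range. This justifies the
  definite description in \<open>proj_onto\<close>.\<close>

lemma orth_projection_range_inject:
  assumes "orth_projection P" "orth_projection Q" "range P = range Q"
  shows "P = Q"
proof
  fix x
  show "P x = Q x"
    by (rule orthogonal_decomposition_unique[OF csubspace_range[OF assms(1)], of _ x])
      (use assms orth_projection_orthogonal[of P _ x] orth_projection_orthogonal[of Q _ x] in auto)
qed

lemma proj_onto_eqI: "orth_projection P \<Longrightarrow> range P = M \<Longrightarrow> proj_onto M = P"
  unfolding proj_onto_def by (rule the_equality) (auto intro: orth_projection_range_inject)

lemma proj_onto_range [simp]: "orth_projection P \<Longrightarrow> proj_onto (range P) = P"
  by (rule proj_onto_eqI) auto

lemma
  assumes "csubspace M" "closed M"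
  shows orth_projection_proj_onto: "orth_projection (proj_onto M)"
    and range_proj_onto: "range (proj_onto M) = M"
proof -
  obtain P where "orth_projection P" "range P = M"
    by (rule orth_projection_exists[OF assms])
  moreover from this have "proj_onto M = P" by (rule proj_onto_eqI)
  ultimately show "orth_projection (proj_onto M)" "range (proj_onto M) = M" by simp_all
qed

lemma proj_onto_apply_eqI:
  assumes "csubspace M" "closed M" "m \<in> M" "\<And>w. w \<in> M \<Longrightarrow> cinner w (x - m) = 0"
  shows "proj_onto M x = m"
proof (rule orthogonal_decomposition_unique[OF assms(1)])
  show "proj_onto M x \<in> M" using range_proj_onto[OF assms(1,2)] rangeI by metis
  show "cinner w (x - proj_onto M x) = 0" if "w \<in> M" for w
    using orth_projection_orthogonal[OF orth_projection_proj_onto[OF assms(1,2)]]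
      range_proj_onto[OF assms(1,2)] that by simp
qed (rule assms)+

lemma csubspace_INT: "(\<And>P. P \<in> \<P> \<Longrightarrow> csubspace (f P)) \<Longrightarrow> csubspace (\<Inter>P\<in>\<P>. f P)"
  by (auto simp: csubspace_def)

lemma csubspace_Int: "csubspace M \<Longrightarrow> csubspace N \<Longrightarrow> csubspace (M \<inter> N)"
  by (auto simp: csubspace_def)

lemma
  assumes "\<And>P. P \<in> \<P> \<Longrightarrow> orth_projection P"
  shows orth_projection_proj_Inf: "orth_projection (proj_Inf \<P>)"
    and range_proj_Inf: "range (proj_Inf \<P>) = (\<Inter>P\<in>\<P>. range P)"
proof -
  have "csubspace (\<Inter>P\<in>\<P>. range P)" "closed (\<Inter>P\<in>\<P>. range P)"
    using assms by (auto intro!: csubspace_INT csubspace_range closed_INT closed_range)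
  then show "orth_projection (proj_Inf \<P>)" "range (proj_Inf \<P>) = (\<Inter>P\<in>\<P>. range P)"
    unfolding proj_Inf_def by (auto intro: orth_projection_proj_onto simp: range_proj_onto)
qed

lemma
  assumes "orth_projection P" "orth_projection Q"
  shows orth_projection_proj_inf: "orth_projection (P \<sqinter>\<^sub>p Q)"
    and range_proj_inf: "range (P \<sqinter>\<^sub>p Q) = range P \<inter> range Q"
proof -
  have "csubspace (range P \<inter> range Q)" "closed (range P \<inter> range Q)"
    using assms by (auto intro!: csubspace_Int csubspace_range closed_Int closed_range)
  then show "orth_projection (P \<sqinter>\<^sub>p Q)" "range (P \<sqinter>\<^sub>p Q) = range P \<inter> range Q"
    unfolding proj_inf_def by (auto intro: orth_projection_proj_onto simp: range_proj_onto)
qed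

lemma
  shows csubspace_closed_cspan: "csubspace (closed_cspan S)"
    and closed_closed_cspan: "closed (closed_cspan S)"
proof -
  have "csubspace (closed_cspan S) \<and> closed (closed_cspan S)"
    unfolding closed_cspan_def by (rule hull_in) (auto simp: csubspace_def)
  then show "csubspace (closed_cspan S)" "closed (closed_cspan S)" by auto
qed

lemma closed_cspan_minimal: "S \<subseteq> M \<Longrightarrow> csubspace M \<Longrightarrow> closed M \<Longrightarrow> closed_cspan S \<subseteq> M"
  unfolding closed_cspan_def by (rule hull_minimal) auto

lemma closed_cspan_superset: "S \<subseteq> closed_cspan S"
  unfolding closed_cspan_def by (rule hull_subset)

lemma
  shows orth_projection_proj_sup: "orth_projection (P \<squnion>\<^sub>p Q)"
    and range_proj_sup: "range (P \<squnion>\<^sub>p Q) = closed_cspan (range P \<union> range Q)"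
  unfolding proj_sup_def
  by (auto intro!: orth_projection_proj_onto range_proj_onto csubspace_closed_cspan closed_closed_cspan)

lemma orth_projection_proj_imp: "orth_projection (P \<Rightarrow>\<^sub>p Q)"
  unfolding proj_imp_def by (rule orth_projection_proj_sup)

lemma range_proj_compl: "orth_projection P \<Longrightarrow> range (proj_compl P) = {x. P x = 0}"
  unfolding proj_compl_def
  by (auto simp: orth_projection_diff orth_projection_idem image_iff) (metis diff_zero)

text \<open>The right-hand side is a closed subspace containing both generating ranges, hence their
  closed span. Conversely \<open>x = (x - P x) + P x\<close> splits such an \<open>x\<close> into a
  vector killed by \<open>P\<close> and one in the meet.\<close>

lemma range_proj_imp:
  assumes P: "orth_projection P" and Q: "orth_projection Q"
  shows "range (P \<Rightarrow>\<^sub>p Q) = {x. P x \<in> range Q}"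
proof
  interpret P: bounded_linear P by (rule orth_projection_bounded_linear) fact
  have Psc: "P (c *\<^sub>C x) = c *\<^sub>C P x" for c x
    using orth_projection_clinear[OF P] by (simp add: clinear_def)
  have R: "csubspace (range Q)" "closed (range Q)"
    by (rule csubspace_range closed_range, fact)+
  show "range (P \<Rightarrow>\<^sub>p Q) \<subseteq> {x. P x \<in> range Q}"
    unfolding proj_imp_def range_proj_sup
  proof (rule closed_cspan_minimal)
    show "csubspace {x. P x \<in> range Q}"
      using R(1) unfolding csubspace_def mem_Collect_eq Ball_def P.zero P.add Psc by blast
    have "closed (P -` range Q)"
      using R(2) P.continuous_on[OF continuous_on_id] by (intro closed_vimage) auto
    then show "closed {x. P x \<in> range Q}" by (simp add: vimage_def)
    show "range (proj_compl P) \<union> range (P \<sqinter>\<^sub>p Q) \<subseteq> {x. P x \<in> range Q}"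
    proof
      fix x assume "x \<in> range (proj_compl P) \<union> range (P \<sqinter>\<^sub>p Q)"
      then have "P x = 0 \<or> P x = x \<and> x \<in> range Q"
        unfolding range_proj_compl[OF P] range_proj_inf[OF P Q]
        using orth_projection_range_iff[OF P, of x] by blast
      then show "x \<in> {x. P x \<in> range Q}"
        using R(1) unfolding csubspace_def mem_Collect_eq by metis
    qed
  qed
  show "{x. P x \<in> range Q} \<subseteq> range (P \<Rightarrow>\<^sub>p Q)"
  proof
    fix x assume "x \<in> {x. P x \<in> range Q}"
    then have "P x \<in> range (P \<sqinter>\<^sub>p Q)" unfolding range_proj_inf[OF P Q] by auto
    moreover have "x - P x \<in> range (proj_compl P)"
      unfolding range_proj_compl[OF P] by (simp add: orth_projection_diff orth_projection_idem P)
    ultimately have "x - P x \<in> closed_cspan (range (proj_compl P) \<union> range (P \<sqinter>\<^sub>p Q))"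
      "P x \<in> closed_cspan (range (proj_compl P) \<union> range (P \<sqinter>\<^sub>p Q))"
      by (auto intro!: subsetD[OF closed_cspan_superset])
    then have "(x - P x) + P x \<in> range (P \<Rightarrow>\<^sub>p Q)"
      using csubspace_closed_cspan[of "range (proj_compl P) \<union> range (P \<sqinter>\<^sub>p Q)"]
      unfolding proj_imp_def range_proj_sup csubspace_def by blast
    then show "x \<in> range (P \<Rightarrow>\<^sub>p Q)" by simp
  qed
qed

lemma proj_inf_commute: "P \<sqinter>\<^sub>p Q = Q \<sqinter>\<^sub>p P"
  by (simp add: proj_inf_def Int_commute)

text \<open>
  If \<open>\<psi>\<close> lies under both implications, \<open>P \<psi>\<close> and \<open>Q \<psi>\<close> both equal the projection of \<open>\<psi>\<close> to the meet.
\<close>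

lemma range_proj_imp_both_iff:
  assumes P: "orth_projection P" and Q: "orth_projection Q"
  shows "\<psi> \<in> range (P \<Rightarrow>\<^sub>p Q) \<and> \<psi> \<in> range (Q \<Rightarrow>\<^sub>p P) \<longleftrightarrow> P \<psi> = Q \<psi>"
proof
  assume "\<psi> \<in> range (P \<Rightarrow>\<^sub>p Q) \<and> \<psi> \<in> range (Q \<Rightarrow>\<^sub>p P)"
  then have "P \<psi> \<in> range Q" "Q \<psi> \<in> range P"
    unfolding range_proj_imp[OF P Q] range_proj_imp[OF Q P] by simp_all
  then have *: "P \<psi> \<in> range P \<inter> range Q" "Q \<psi> \<in> range P \<inter> range Q"
    by (simp_all only: IntI rangeI)
  have "csubspace (range P \<inter> range Q)" using P Q by (intro csubspace_Int csubspace_range)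
  then show "P \<psi> = Q \<psi>"
  proof (rule orthogonal_decomposition_unique)
    fix w assume w: "w \<in> range P \<inter> range Q"
    show "cinner w (\<psi> - P \<psi>) = 0" using w by (intro orth_projection_orthogonal[OF P]) blast
    show "cinner w (\<psi> - Q \<psi>) = 0" using w by (intro orth_projection_orthogonal[OF Q]) blast
  qed (rule *)+
next
  assume "P \<psi> = Q \<psi>"
  then have "P \<psi> \<in> range Q" "Q \<psi> \<in> range P" by (metis rangeI)+
  then show "\<psi> \<in> range (P \<Rightarrow>\<^sub>p Q) \<and> \<psi> \<in> range (Q \<Rightarrow>\<^sub>p P)"
    unfolding range_proj_imp[OF P Q] range_proj_imp[OF Q P] by simp
qed

section \<open>Truth values\<close>

text \<open>The classical truth values inside the lattice; equations between \<open>check\<close>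
  sets take no others.\<close>

definition proj_bool :: "bool \<Rightarrow> 'a::chilbert_space \<Rightarrow> 'a" where
  "proj_bool b = (if b then id else (\<lambda>_. 0))"

lemma orth_projection_zero_map: "orth_projection (\<lambda>_. 0 :: 'a::chilbert_space)"
  by (rule orth_projectionI) (auto simp: clinear_def)

lemma orth_projection_proj_bool: "orth_projection (proj_bool b)"
  by (simp add: proj_bool_def orth_projection_id orth_projection_zero_map)

lemma range_proj_bool: "range (proj_bool b :: 'a::chilbert_space \<Rightarrow> 'a) = (if b then UNIV else {0})"
  by (auto simp: proj_bool_def)

lemma proj_inf_proj_bool:
  assumes "orth_projection P"
  shows "P \<sqinter>\<^sub>p proj_bool b = (if b then P else proj_bool False)"
proof -
  have "0 \<in> range P" using csubspace_range[OF assms] by (simp add: csubspace_def)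
  then have "range P \<inter> range (proj_bool b) = range (if b then P else proj_bool False)"
    by (auto simp: range_proj_bool)
  then show ?thesis
    unfolding proj_inf_def using assms orth_projection_proj_bool
    by (intro proj_onto_eqI) auto
qed

lemma proj_imp_proj_bool_True:
  assumes "orth_projection P"
  shows "id \<Rightarrow>\<^sub>p P = P"
proof (rule orth_projection_range_inject[OF orth_projection_proj_imp assms])
  show "range (id \<Rightarrow>\<^sub>p P) = range P"
    unfolding range_proj_imp[OF orth_projection_id assms] by simp
qed

lemma proj_Inf_proj_bool: "proj_Inf ((\<lambda>x. proj_bool (p x)) ` S) = proj_bool (\<forall>x\<in>S. p x)"
  unfolding proj_Inf_def
  by (rule proj_onto_eqI) (auto simp: orth_projection_proj_bool range_proj_bool)

text \<open>Only the index \<open>s = a\<close> can contribute to the supremum. A general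
  \<open>Q\<close> covers membership both in a check set, where \<open>Q\<close> is
  \<open>id\<close>, and in \<open>qreal E\<close>.\<close>

lemma proj_Sup_proj_bool:
  assumes "\<And>s. s \<in> S \<Longrightarrow> orth_projection (Q s)"
  shows "proj_Sup ((\<lambda>s. Q s \<sqinter>\<^sub>p proj_bool (a = s)) ` S) = (if a \<in> S then Q a else proj_bool False)"
proof -
  define R where "R = (if a \<in> S then Q a else proj_bool False)"
  have R: "orth_projection R" using assms orth_projection_proj_bool by (auto simp: R_def)
  have U: "(\<Union>P\<in>(\<lambda>s. Q s \<sqinter>\<^sub>p proj_bool (a = s)) ` S. range P)
      = (\<Union>s\<in>S. range (if a = s then Q a else proj_bool False))" (is "?U = _")
    unfolding image_image
    by (intro SUP_cong refl) (simp add: proj_inf_proj_bool[OF assms])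
  have "closed_cspan ?U = range R"
  proof
    have "0 \<in> range R" using csubspace_range[OF R] by (simp add: csubspace_def)
    then have "?U \<subseteq> range R" unfolding U by (auto simp: R_def proj_bool_def image_iff)
    then show "closed_cspan ?U \<subseteq> range R"
      using R by (intro closed_cspan_minimal csubspace_range closed_range)
    show "range R \<subseteq> closed_cspan ?U"
    proof (cases "a \<in> S")
      case True
      then have "range R \<subseteq> ?U" unfolding U by (auto simp: R_def)
      then show ?thesis using closed_cspan_superset by (rule order_trans)
    next
      case False
      \<comment> \<open>Here \<open>range R\<close> is the zero space; the union may even be empty,
        but its closed span contains 0.\<close>
      then show ?thesis
        using csubspace_closed_cspan[of ?U] by (auto simp: R_def range_proj_bool csubspace_def)
    qed
  qed
  then have "proj_Sup ((\<lambda>s. Q s \<sqinter>\<^sub>p proj_bool (a = s)) ` S) = R"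
    unfolding proj_Sup_def using R by simp
  then show ?thesis by (simp only: R_def)
qed

lemma qeq_commute: "qeq u v = qeq v u"
  by (simp only: qeq.simps[of u v] qeq.simps[of v u] proj_inf_commute)

lemma hcset_eq_iff: "v = w \<longleftrightarrow> (\<forall>x. x \<in> rcset (hcelts v) \<longleftrightarrow> x \<in> rcset (hcelts w))"
  by (cases v; cases w) (auto simp flip: rcset_inject)

text \<open>Induction on \<open>v\<close> for all \<open>w\<close> at once: unfolding both
  memberships leaves only equations between an element of \<open>v\<close> and an element of
  \<open>w\<close>, so the lattice operations act on classical truth values.\<close>

lemma qeq_check: "qeq (check v) (check w) = (proj_bool (v = w) :: 'a::chilbert_space \<Rightarrow> 'a)"
proof (induction v arbitrary: w)
  case (HCSet S)
  let ?v = "HCSet S"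
  have mem1: "qmem (check v') (check w) = (proj_bool (v' \<in> rcset (hcelts w)) :: 'a \<Rightarrow> 'a)"
    if "v' \<in> rcset S" for v'
  proof -
    have "qmem (check v') (check w) =
        proj_Sup ((\<lambda>w'. id \<sqinter>\<^sub>p (proj_bool (v' = w') :: 'a \<Rightarrow> 'a)) ` rcset (hcelts w))"
      by (simp add: qmem.simps[of "check v'"] qgraph_check image_image HCSet.IH[OF that] del: check.simps)
    also have "\<dots> = proj_bool (v' \<in> rcset (hcelts w))"
      by (subst proj_Sup_proj_bool) (auto simp: orth_projection_id proj_bool_def)
    finally show ?thesis .
  qed
  \<comment> \<open>The element of \<open>v\<close> now stands on the right, so the induction
    hypothesis is applied after \<open>qeq_commute\<close>.\<close>
  have mem2: "qmem (check w') (check ?v) = (proj_bool (w' \<in> rcset S) :: 'a \<Rightarrow> 'a)" for w'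
  proof -
    have "qmem (check w') (check ?v) =
        proj_Sup ((\<lambda>v'. id \<sqinter>\<^sub>p (proj_bool (w' = v') :: 'a \<Rightarrow> 'a)) ` rcset S)"
      unfolding qmem.simps[of "check w'"] qgraph_check image_image
      using HCSet.IH by (intro arg_cong[where f = proj_Sup] image_cong)
        (auto simp: qeq_commute[of "check w'"] eq_commute)
    also have "\<dots> = proj_bool (w' \<in> rcset S)"
      by (subst proj_Sup_proj_bool) (auto simp: orth_projection_id proj_bool_def)
    finally show ?thesis .
  qed
  have "proj_Inf ((\<lambda>(u', P). P \<Rightarrow>\<^sub>p qmem u' (check w)) ` qgraph (check ?v)) =
      proj_Inf ((\<lambda>v'. proj_bool (v' \<in> rcset (hcelts w)) :: 'a \<Rightarrow> 'a) ` rcset S)"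
    unfolding qgraph_check image_image
    by (intro arg_cong[where f = proj_Inf] image_cong)
      (auto simp: mem1 proj_imp_proj_bool_True orth_projection_proj_bool)
  moreover have "proj_Inf ((\<lambda>(v', Q). Q \<Rightarrow>\<^sub>p qmem v' (check ?v)) ` qgraph (check w)) =
      proj_Inf ((\<lambda>w'. proj_bool (w' \<in> rcset S) :: 'a \<Rightarrow> 'a) ` rcset (hcelts w))"
    unfolding qgraph_check image_image
    by (intro arg_cong[where f = proj_Inf] image_cong)
      (auto simp: mem2 proj_imp_proj_bool_True orth_projection_proj_bool simp del: check.simps)
  ultimately have "qeq (check ?v) (check w) =
      (proj_bool (\<forall>v'\<in>rcset S. v' \<in> rcset (hcelts w)) :: 'a \<Rightarrow> 'a)
      \<sqinter>\<^sub>p proj_bool (\<forall>w'\<in>rcset (hcelts w). w' \<in> rcset S)"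
    by (simp only: qeq.simps[of "check ?v"] proj_Inf_proj_bool)
  also have "\<dots> = proj_bool (?v = w)"
    unfolding proj_inf_proj_bool[OF orth_projection_proj_bool] hcset_eq_iff[of ?v w]
    by (auto simp: proj_bool_def)
  finally show ?case .
qed

text \<open>Distinct rationals have distinct codes, so only the term \<open>s = r\<close> survives
  in the supremum.\<close>

lemma qmem_check_qreal:
  fixes E :: "real \<Rightarrow> 'a::chilbert_space \<Rightarrow> 'a"
  assumes "\<And>r. orth_projection (E r)"
  shows "qmem (check (rat_set r)) (qreal E) = E (of_rat r)"
proof -
  have "qmem (check (rat_set r)) (qreal E) =
      proj_Sup ((\<lambda>s. E (of_rat s) \<sqinter>\<^sub>p (proj_bool (r = s) :: 'a \<Rightarrow> 'a)) ` UNIV)"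
    by (simp add: qmem.simps[of "check (rat_set r)"] qgraph_qreal image_image qeq_check rat_set_eq_iff)
  also have "\<dots> = E (of_rat r)"
    by (subst proj_Sup_proj_bool) (auto simp: assms)
  finally show ?thesis .
qed

text \<open>Meets become intersections of ranges, so \<psi> has to lie under both implications for
  each rational \<open>r\<close>; \<open>range_proj_imp_both_iff\<close> turns this into equality at
  \<psi>.\<close>

lemma range_qeq_qreal:
  fixes E F :: "real \<Rightarrow> 'a::chilbert_space \<Rightarrow> 'a"
  assumes E: "\<And>r. orth_projection (E r)" and F: "\<And>r. orth_projection (F r)"
  shows "\<psi> \<in> range (qeq (qreal E) (qreal F)) \<longleftrightarrow> (\<forall>r::rat. E (of_rat r) \<psi> = F (of_rat r) \<psi>)"
proof -
  have "qeq (qreal E) (qreal F) =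
      proj_Inf (range (\<lambda>r::rat. E (of_rat r) \<Rightarrow>\<^sub>p F (of_rat r)))
      \<sqinter>\<^sub>p proj_Inf (range (\<lambda>r::rat. F (of_rat r) \<Rightarrow>\<^sub>p E (of_rat r)))"
    by (simp add: qeq.simps[of "qreal E"] qgraph_qreal image_image qmem_check_qreal E F)
  moreover have "orth_projection (proj_Inf (range (\<lambda>r::rat. P r \<Rightarrow>\<^sub>p Q r)))"
    "range (proj_Inf (range (\<lambda>r::rat. P r \<Rightarrow>\<^sub>p Q r))) = (\<Inter>r. range (P r \<Rightarrow>\<^sub>p Q r))"
    for P Q :: "rat \<Rightarrow> 'a \<Rightarrow> 'a"
  proof -
    have *: "orth_projection R" if "R \<in> range (\<lambda>r::rat. P r \<Rightarrow>\<^sub>p Q r)" for R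
      using that orth_projection_proj_imp by auto
    show "orth_projection (proj_Inf (range (\<lambda>r::rat. P r \<Rightarrow>\<^sub>p Q r)))"
      using * by (rule orth_projection_proj_Inf)
    show "range (proj_Inf (range (\<lambda>r::rat. P r \<Rightarrow>\<^sub>p Q r))) = (\<Inter>r. range (P r \<Rightarrow>\<^sub>p Q r))"
      by (subst range_proj_Inf) (auto intro: * simp: image_image)
  qed
  ultimately have "range (qeq (qreal E) (qreal F)) =
      (\<Inter>r::rat. range (E (of_rat r) \<Rightarrow>\<^sub>p F (of_rat r))) \<inter> (\<Inter>r::rat. range (F (of_rat r) \<Rightarrow>\<^sub>p E (of_rat r)))"
    by (simp only: range_proj_inf)
  then have "\<psi> \<in> range (qeq (qreal E) (qreal F)) \<longleftrightarrow>
      (\<forall>r::rat. \<psi> \<in> range (E (of_rat r) \<Rightarrow>\<^sub>p F (of_rat r)) \<and> \<psi> \<in> range (F (of_rat r) \<Rightarrow>\<^sub>p E (of_rat r)))"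
    by (simp only: Int_iff INT_iff all_conj_distrib UNIV_I ball_simps simp_thms Ball_def)
  then show ?thesis unfolding range_proj_imp_both_iff[OF E F] .
qed

section \<open>Series of projections and bounded Borel functions\<close>

lemma orth_projection_proj_compl:
  assumes P: "orth_projection P"
  shows "orth_projection (proj_compl P)"
proof (rule orth_projectionI)
  have "bounded_clinear (\<lambda>x. id x - P x)"
    using orth_projection_id P by (intro bounded_clinear_diff orth_projection_bounded_clinear)
  then show "clinear (proj_compl P)" by (simp add: proj_compl_def bounded_clinear_def)
qed (simp_all add: proj_compl_def orth_projection_diff[OF P] orth_projection_idem[OF P]
    cinner.diff_left cinner.diff_right orth_projection_adjoint[OF P])

text \<open>Partial sums are increasing projections. Their squared norms at \<open>x\<close>
  increase and are bounded, hence Cauchy, and Pythagoras transfers this to the vectors. The series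
  of squared norms is recorded for comparison with countably additive measures.\<close>

lemma orth_projection_sums:
  fixes P :: "nat \<Rightarrow> 'a::chilbert_space \<Rightarrow> 'a"
  assumes P: "\<And>i. orth_projection (P i)" and orth: "\<And>i j x. i \<noteq> j \<Longrightarrow> P i (P j x) = 0"
  obtains Q where "orth_projection Q" "\<And>x. (\<lambda>i. P i x) sums Q x"
    "\<And>x. (\<lambda>i. (norm (P i x))\<^sup>2) sums (norm (Q x))\<^sup>2"
proof -
  define S where "S n x = (\<Sum>i<n. P i x)" for n x
  have S_lin: "linear (S n)" for n
    unfolding S_def
    using P orth_projection_bounded_linear bounded_linear.linear by (intro linear_compose_sum ballI) blast
  \<comment> \<open>Absorption of later partial sums; the case \<open>m = n\<close> is
    idempotence.\<close>
  have S_comp: "S m (S n x) = S m x" if "m \<le> n" for m n x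
  proof -
    have "P i (S n x) = P i x" if "i < m" for i
    proof -
      have "P i (S n x) = (\<Sum>j<n. P i (P j x))"
        unfolding S_def using orth_projection_bounded_linear[OF P] bounded_linear.linear linear_sum by blast
      also have "\<dots> = (\<Sum>j<n. if j = i then P i x else 0)"
        by (intro sum.cong refl) (auto simp: orth orth_projection_idem[OF P])
      finally show ?thesis using \<open>i < m\<close> \<open>m \<le> n\<close> by simp
    qed
    then show ?thesis by (simp add: S_def)
  qed
  have S: "orth_projection (S n)" for n
  proof (rule orth_projectionI)
    show "clinear (S n)"
      unfolding clinear_def
    proof safe
      fix c x
      have "S n (c *\<^sub>C x) = (\<Sum>i<n. c *\<^sub>C P i x)"
        unfolding S_def using orth_projection_clinear[OF P] by (simp add: clinear_def)
      then show "S n (c *\<^sub>C x) = c *\<^sub>C S n x"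
        unfolding S_def using linear_sum[OF bounded_linear.linear[OF bounded_linear_scaleC]] by metis
    qed (rule linear_add[OF S_lin])
    show "cinner (S n x) y = cinner x (S n y)" for x y
      by (simp add: S_def cinner.sum_left cinner.sum_right orth_projection_adjoint[OF P])
  qed (rule S_comp, simp)
  define a where "a x n = (norm (S n x))\<^sup>2" for x n
  have a_eq: "a x n = (\<Sum>i<n. (norm (P i x))\<^sup>2)" for x n
  proof -
    have "complex_of_real (a x n) = complex_of_real (\<Sum>i<n. (norm (P i x))\<^sup>2)"
      unfolding a_def orth_projection_quadratic[OF S, symmetric] of_real_sum
        orth_projection_quadratic[OF P, symmetric]
      by (simp add: S_def cinner.sum_right)
    then show ?thesis using of_real_eq_iff by blast
  qed
  \<comment> \<open>Pythagoras for \<open>S m\<close> at the vector \<open>S n x\<close>.\<close>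
  have diff: "(norm (S n x - S m x))\<^sup>2 = a x n - a x m" if "m \<le> n" for m n x
    using orth_projection_norm_diff[OF S, of "S n x" m] S_comp[OF that] by (simp add: a_def)
  have conv: "convergent (\<lambda>n. S n x)" for x
  proof -
    have "a x n \<le> (norm x)\<^sup>2" for n
      unfolding a_def using orth_projection_norm_le[OF S] by (intro power_mono) auto
    moreover have "incseq (a x)"
      unfolding a_eq by (intro incseq_SucI) simp
    ultimately obtain L where "a x \<longlonglongrightarrow> L"
      using incseq_convergent[of "a x" "(norm x)\<^sup>2"] by blast
    then have Ca: "Cauchy (a x)" using LIMSEQ_imp_Cauchy by blast
    have "Cauchy (\<lambda>n. S n x)"
    proof (rule CauchyI)
      fix e :: real assume "0 < e"
      then obtain N where N: "\<And>m n. m \<ge> N \<Longrightarrow> n \<ge> N \<Longrightarrow> norm (a x m - a x n) < e\<^sup>2"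
        using CauchyD[OF Ca, of "e\<^sup>2"] by auto
      have "norm (S m x - S n x) < e" if "m \<ge> N" "n \<ge> N" for m n
      proof -
        have "(norm (S m x - S n x))\<^sup>2 = \<bar>a x m - a x n\<bar>"
          using diff[of m n x] diff[of n m x] zero_le_power2[of "norm (S m x - S n x)"]
          by (cases "m \<le> n") (auto simp: norm_minus_commute)
        also have "\<dots> < e\<^sup>2" using N[OF that] by simp
        finally show ?thesis using \<open>0 < e\<close> by (simp add: power2_less_imp_less)
      qed
      then show "\<exists>N. \<forall>m\<ge>N. \<forall>n\<ge>N. norm (S m x - S n x) < e" by blast
    qed
    then show ?thesis by (rule Cauchy_convergent)
  qed
  define Q where "Q x = lim (\<lambda>n. S n x)" for x
  have lim: "(\<lambda>n. S n x) \<longlonglongrightarrow> Q x" for x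
    unfolding Q_def using conv by (simp add: convergent_LIMSEQ_iff)
  have "orth_projection Q"
  proof (rule orth_projectionI)
    show "clinear Q"
      unfolding clinear_def
    proof safe
      fix x y
      have "(\<lambda>n. S n (x + y)) \<longlonglongrightarrow> Q x + Q y"
        unfolding orth_projection_add[OF S] by (intro tendsto_add lim)
      then show "Q (x + y) = Q x + Q y" by (rule LIMSEQ_unique[OF lim])
    next
      fix c x
      have "S n (c *\<^sub>C x) = c *\<^sub>C S n x" for n
        using orth_projection_clinear[OF S] by (simp add: clinear_def)
      then have "(\<lambda>n. S n (c *\<^sub>C x)) \<longlonglongrightarrow> c *\<^sub>C Q x"
        using bounded_linear.tendsto[OF bounded_linear_scaleC lim] by simp
      then show "Q (c *\<^sub>C x) = c *\<^sub>C Q x" by (rule LIMSEQ_unique[OF lim])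
    qed
    show "cinner (Q x) y = cinner x (Q y)" for x y
    proof (rule LIMSEQ_unique)
      show "(\<lambda>n. cinner (S n x) y) \<longlonglongrightarrow> cinner (Q x) y"
        by (intro cinner.tendsto lim tendsto_const)
      show "(\<lambda>n. cinner (S n x) y) \<longlonglongrightarrow> cinner x (Q y)"
        unfolding orth_projection_adjoint[OF S] by (intro cinner.tendsto lim tendsto_const)
    qed
    show "Q (Q x) = Q x" for x
    proof -
      \<comment> \<open>Absorption passes to the limit in the inner index; letting \<open>m\<close>
        grow then gives idempotence of \<open>Q\<close>.\<close>
      have "S m (Q x) = S m x" for m
      proof (rule LIMSEQ_unique)
        show "(\<lambda>n. S m (S n x)) \<longlonglongrightarrow> S m (Q x)"
          by (rule bounded_linear.tendsto[OF orth_projection_bounded_linear[OF S] lim])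
        show "(\<lambda>n. S m (S n x)) \<longlonglongrightarrow> S m x"
          by (rule tendsto_eventually) (auto simp: eventually_sequentially S_comp intro!: exI[of _ m])
      qed
      then show ?thesis using LIMSEQ_unique[OF lim[of "Q x"]] lim[of x] by simp
    qed
  qed
  moreover have "(\<lambda>i. P i x) sums Q x" for x
    unfolding sums_def using lim by (simp add: S_def)
  moreover have "(\<lambda>i. (norm (P i x))\<^sup>2) sums (norm (Q x))\<^sup>2" for x
    unfolding sums_def a_eq[symmetric] a_def by (intro tendsto_intros lim)
  ultimately show thesis by (rule that)
qed

text \<open>
  The rate in the last case comes from rounding \<open>f\<close> down to a multiple of \<open>1 / (n + 1)\<close>.
\<close>

lemma bounded_borel_induct [consumes 2, case_names indicator add scale lim]:
  fixes f :: "'b::topological_space \<Rightarrow> complex"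
  assumes f: "f \<in> borel_measurable borel" "bounded (range f)"
    and ind: "\<And>A. A \<in> sets borel \<Longrightarrow> P (indicator A)"
    and add: "\<And>f g. \<lbrakk>f \<in> borel_measurable borel; bounded (range f); P f;
        g \<in> borel_measurable borel; bounded (range g); P g\<rbrakk> \<Longrightarrow> P (\<lambda>t. f t + g t)"
    and scale: "\<And>c f. \<lbrakk>f \<in> borel_measurable borel; bounded (range f); P f\<rbrakk> \<Longrightarrow> P (\<lambda>t. c * f t)"
    and lim: "\<And>F f. \<lbrakk>\<And>n. F n \<in> borel_measurable borel; \<And>n. bounded (range (F n)); \<And>n::nat. P (F n);
        f \<in> borel_measurable borel; bounded (range f);
        \<And>n t. cmod (F n t - f t) \<le> 1 / Suc n\<rbrakk> \<Longrightarrow> P f"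
  shows "P f"
proof -
  \<comment> \<open>Carrying measurability and boundedness along with \<open>P\<close> lets the
    closure rules be chained.\<close>
  define Q where "Q f \<longleftrightarrow> f \<in> borel_measurable borel \<and> bounded (range f) \<and> P f" for f
  have Q_ind: "Q (indicator A)" if "A \<in> sets borel" for A
    unfolding Q_def using that ind
    by (auto simp: bounded_iff indicator_def intro!: exI[of _ 1])
  have Q_add: "Q (\<lambda>t. f t + g t)" if "Q f" "Q g" for f g
    using that add unfolding Q_def by (auto intro: bounded_plus_comp)
  have Q_scale: "Q (\<lambda>t. c * f t)" if "Q f" for c f
  proof -
    have "bounded (range (\<lambda>t. c * f t))"
      using that bounded_linear_image[OF _ bounded_linear_mult_right[of c], of "range f"]
      by (simp add: Q_def image_image)
    then show ?thesis using that scale unfolding Q_def by auto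
  qed
  have Q_sum: "Q (\<lambda>t. \<Sum>k\<in>K. f k t)" if "finite K" "\<And>k. k \<in> K \<Longrightarrow> Q (f k)"
    for f :: "int \<Rightarrow> 'b \<Rightarrow> complex" and K
    using that
  proof (induction K rule: finite_induct)
    case empty
    \<comment> \<open>The rules start from indicators only, so the empty sum enters as the indicator
      of the empty set.\<close>
    have "(\<lambda>t. 0) = (indicator {} :: 'b \<Rightarrow> complex)" by auto
    then show ?case using Q_ind[of "{}"] by simp
  next
    case (insert k K)
    then show ?case by (simp add: Q_add)
  qed
  have Q_real: "Q (\<lambda>t. complex_of_real (g t))"
    if g: "g \<in> borel_measurable borel" "bounded (range g)" for g :: "'b \<Rightarrow> real"
  proof -
    obtain b where b: "\<And>t. \<bar>g t\<bar> \<le> b" using g(2) by (auto simp: bounded_iff)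
    define F where "F n t = complex_of_real (\<lfloor>real (Suc n) * g t\<rfloor> / real (Suc n))" for n t
    have QF: "Q (F n)" for n
    proof -
      define A where "A k = {t. \<lfloor>real (Suc n) * g t\<rfloor> = k}" for k
      \<comment> \<open>All values of the floor lie in this finite interval because \<open>g\<close>
        is bounded by \<open>b\<close>, so \<open>F n\<close> is a finite sum.\<close>
      define K where "K = {\<lfloor>- (real (Suc n) * b)\<rfloor>..\<lfloor>real (Suc n) * b\<rfloor>}"
      have A: "A k \<in> sets borel" for k unfolding A_def using g(1) by measurable
      have in_K: "\<lfloor>real (Suc n) * g t\<rfloor> \<in> K" for t
      proof -
        have "- b \<le> g t" "g t \<le> b" using b[of t] by auto
        then have "real (Suc n) * (- b) \<le> real (Suc n) * g t" "real (Suc n) * g t \<le> real (Suc n) * b"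
          by (intro mult_left_mono; simp)+
        then show ?thesis unfolding K_def by (auto intro!: floor_mono simp del: of_nat_Suc)
      qed
      have "F n t = (\<Sum>k\<in>K. complex_of_real (k / Suc n) * indicator (A k) t)" for t
      proof -
        have "(\<Sum>k\<in>K. complex_of_real (k / Suc n) * indicator (A k) t) =
            (\<Sum>k\<in>K. if k = \<lfloor>real (Suc n) * g t\<rfloor> then F n t else 0)"
          by (intro sum.cong refl) (auto simp: A_def F_def indicator_def simp del: of_nat_Suc)
        also have "\<dots> = F n t" using in_K[of t] by (simp add: K_def del: of_nat_Suc)
        finally show ?thesis by simp
      qed
      then have "F n = (\<lambda>t. \<Sum>k\<in>K. complex_of_real (k / Suc n) * indicator (A k) t)" by blast
      moreover have "Q \<dots>" by (intro Q_sum Q_scale Q_ind A) (simp add: K_def)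
      ultimately show ?thesis by simp
    qed
    have "cmod (F n t - complex_of_real (g t)) \<le> 1 / Suc n" for n t
    proof -
      have "cmod (F n t - complex_of_real (g t)) = \<bar>\<lfloor>real (Suc n) * g t\<rfloor> / real (Suc n) - g t\<bar>"
        unfolding F_def of_real_diff[symmetric] norm_of_real ..
      also have "\<dots> = \<bar>\<lfloor>real (Suc n) * g t\<rfloor> - real (Suc n) * g t\<bar> / real (Suc n)"
        by (simp add: diff_divide_eq_iff divide_simps abs_mult mult.commute del: of_nat_Suc)
      also have "\<dots> \<le> 1 / real (Suc n)"
        by (intro divide_right_mono) linarith+
      finally show ?thesis .
    qed
    moreover have "bounded (range (\<lambda>t. complex_of_real (g t)))"
      using b by (auto simp: bounded_iff intro!: exI[of _ b])
    ultimately show ?thesis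
      using QF lim[of F "\<lambda>t. complex_of_real (g t)"] g(1) by (auto simp: Q_def)
  qed
  obtain b where b: "\<And>t. cmod (f t) \<le> b" using f(2) by (auto simp: bounded_iff)
  have "bounded (range (\<lambda>t. Re (f t)))" "bounded (range (\<lambda>t. Im (f t)))"
    using order_trans[OF abs_Re_le_cmod b] order_trans[OF abs_Im_le_cmod b]
    by (auto simp: bounded_iff)
  then have "Q (\<lambda>t. complex_of_real (Re (f t)) + \<i> * complex_of_real (Im (f t)))"
    using f(1) by (intro Q_add Q_scale Q_real) auto
  then show ?thesis by (simp add: Q_def complex_eq[symmetric])
qed

section \<open>The spectral measure and the functional calculus\<close>

text \<open>The condition under the definite description in \<open>fcalc\<close>, named so that
  operators can be exhibited for it and combined.\<close>

definition represents :: "(real \<Rightarrow> 'a::chilbert_space \<Rightarrow> 'a) \<Rightarrow> (real \<Rightarrow> complex) \<Rightarrow> ('a \<Rightarrow> 'a) \<Rightarrow> bool" where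
  "represents E f T \<longleftrightarrow> bounded_clinear T \<and> (\<forall>x. cinner x (T x) = (\<integral>t. f t \<partial>spectral_measure E x))"

text \<open>By polarization, equal quadratic forms come from the same operator.\<close>

lemma represents_unique: "represents E f S \<Longrightarrow> represents E f T \<Longrightarrow> S = T"
  unfolding represents_def bounded_clinear_def by (metis clinear_eqI_quadratic)

lemma fcalc_eqI: "represents E f T \<Longrightarrow> fcalc E f = T"
  unfolding fcalc_def represents_def[symmetric]
  by (rule the_equality) (auto intro: represents_unique)

locale spectral_resolution =
  fixes E :: "real \<Rightarrow> 'a::chilbert_space \<Rightarrow> 'a"
  assumes resolution: "resolution_of_identity E"
begin

abbreviation \<nu> :: "'a \<Rightarrow> real measure" where "\<nu> \<equiv> spectral_measure E"

lemma orth_projection_E: "orth_projection (E r)"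
  using resolution by (simp add: resolution_of_identity_def)

lemma sets_\<nu> [simp, measurable_cong]: "sets (\<nu> x) = sets borel"
  and space_\<nu> [simp]: "space (\<nu> x) = UNIV"
  by (simp_all add: spectral_measure_def)

section \<open>The Stieltjes measures of vectors\<close>

text \<open>The distribution function at \<open>r\<close> is the squared norm of
  \<open>E r x\<close>; nested ranges make it monotone, and the limit axioms give right continuity
  and its limits at both ends.\<close>

lemma
  shows finite_measure_\<nu>: "finite_measure (\<nu> x)"
    and measure_\<nu>_UNIV: "measure (\<nu> x) UNIV = (norm x)\<^sup>2"
    and measure_\<nu>_atMost: "measure (\<nu> x) {..r} = (norm (E r x))\<^sup>2"
proof -
  let ?F = "\<lambda>r. Re (cinner x (E r x))"
  have F: "?F r = (norm (E r x))\<^sup>2" for r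
    by (simp add: orth_projection_quadratic[OF orth_projection_E] del: of_real_power)
  have mono: "?F r \<le> ?F s" if "r \<le> s" for r s
  proof -
    \<comment> \<open>Both sides are the foot of \<open>x\<close> in \<open>range (E r)\<close>,
      because \<open>range (E s)\<close> contains that range.\<close>
    have "E r x = E r (E s x)"
    proof (rule orthogonal_decomposition_unique[OF csubspace_range[OF orth_projection_E[of r]], of _ x])
      fix w assume w: "w \<in> range (E r)"
      then have w': "w \<in> range (E s)" using resolution that unfolding resolution_of_identity_def by blast
      show "cinner w (x - E r x) = 0" using w by (rule orth_projection_orthogonal[OF orth_projection_E])
      have "cinner w (x - E r (E s x)) = cinner w (x - E s x) + cinner w (E s x - E r (E s x))"
        by (simp add: cinner.diff_right)
      also have "\<dots> = 0"
        using orth_projection_orthogonal[OF orth_projection_E w] orth_projection_orthogonal[OF orth_projection_E w']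
        by simp
      finally show "cinner w (x - E r (E s x)) = 0" .
    qed auto
    then have "norm (E r x) \<le> norm (E s x)"
      using orth_projection_norm_le[OF orth_projection_E, of r "E s x"] by simp
    then show ?thesis unfolding F by (intro power_mono) auto
  qed
  have lim: "(?F \<longlongrightarrow> Re (cinner x y)) G" if "((\<lambda>r. E r x) \<longlongrightarrow> y) G" for y G
    by (intro tendsto_Re cinner.tendsto tendsto_const that)
  have right: "continuous (at_right a) ?F" for a
    unfolding continuous_within
    using resolution by (intro lim) (auto simp: resolution_of_identity_def)
  have bot: "(?F \<longlongrightarrow> 0) at_bot"
    using lim[of 0 at_bot] resolution by (simp add: resolution_of_identity_def)
  have top: "(?F \<longlongrightarrow> (norm x)\<^sup>2) at_top"
    using lim[of x at_top] resolution by (simp add: resolution_of_identity_def cinner_self del: of_real_power)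
  have "finite_borel_measure (\<nu> x)"
    unfolding spectral_measure_def
    by (rule finite_borel_measure_interval_measure[OF mono right bot top]) auto
  then show "finite_measure (\<nu> x)" by (rule finite_borel_measure.axioms)
  have "emeasure (\<nu> x) UNIV = ennreal ((norm x)\<^sup>2)"
    unfolding spectral_measure_def
    by (rule interval_measure_UNIV[OF mono right bot top]) auto
  then show "measure (\<nu> x) UNIV = (norm x)\<^sup>2" by (simp add: measure_def)
  have "measure (\<nu> x) {..r} = ?F r"
    unfolding spectral_measure_def
    by (rule measure_interval_measure_Iic[OF mono right bot])
  then show "measure (\<nu> x) {..r} = (norm (E r x))\<^sup>2" unfolding F .
qed

lemma integrable_\<nu>:
  fixes f :: "real \<Rightarrow> complex"
  assumes "f \<in> borel_measurable borel" "bounded (range f)"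
  shows "integrable (\<nu> x) f"
proof -
  obtain b where "\<And>t. cmod (f t) \<le> b" using assms(2) by (auto simp: bounded_iff)
  moreover have "f \<in> borel_measurable (\<nu> x)"
    using assms(1) by (simp cong: measurable_cong_sets)
  ultimately show ?thesis
    by (intro finite_measure.integrable_const_bound[OF finite_measure_\<nu>, of _ b]) auto
qed

lemma cmod_integral_\<nu>_le:
  fixes f :: "real \<Rightarrow> complex"
  assumes "f \<in> borel_measurable borel" "\<And>t. cmod (f t) \<le> e"
  shows "cmod (\<integral>t. f t \<partial>\<nu> x) \<le> e * (norm x)\<^sup>2"
proof -
  have "bounded (range f)" using assms(2) by (auto simp: bounded_iff)
  with assms(1) have int: "integrable (\<nu> x) f" by (rule integrable_\<nu>)
  interpret finite_measure "\<nu> x" by (rule finite_measure_\<nu>)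
  have "cmod (\<integral>t. f t \<partial>\<nu> x) \<le> (\<integral>t. cmod (f t) \<partial>\<nu> x)" by (rule integral_norm_bound)
  also have "\<dots> \<le> (\<integral>t. e \<partial>\<nu> x)"
    using int assms(2) by (intro integral_mono) auto
  also have "\<dots> = e * (norm x)\<^sup>2" by (simp add: measure_\<nu>_UNIV)
  finally show ?thesis .
qed

section \<open>Spectral projections of Borel sets\<close>

text \<open>The measure of the vector \<open>Q x\<close> already gives \<open>B\<close> its full
  mass, since \<open>Q\<close> fixes \<open>Q x\<close>; nothing is left for the disjoint set
  \<open>A\<close>.\<close>

lemma projections_of_disjoint:
  assumes P: "orth_projection P" "\<And>x. (norm (P x))\<^sup>2 = measure (\<nu> x) A"
    and Q: "orth_projection Q" "\<And>x. (norm (Q x))\<^sup>2 = measure (\<nu> x) B"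
    and AB: "A \<in> sets borel" "B \<in> sets borel" "A \<inter> B = {}"
  shows "P (Q x) = 0"
proof -
  interpret finite_measure "\<nu> (Q x)" by (rule finite_measure_\<nu>)
  have "measure (\<nu> (Q x)) A + measure (\<nu> (Q x)) B = measure (\<nu> (Q x)) (A \<union> B)"
    using AB by (intro finite_measure_Union[symmetric]) auto
  also have "\<dots> \<le> measure (\<nu> (Q x)) UNIV" using AB by (intro finite_measure_mono) auto
  finally have "(norm (P (Q x)))\<^sup>2 + (norm (Q (Q x)))\<^sup>2 \<le> (norm (Q x))\<^sup>2"
    by (simp add: P Q measure_\<nu>_UNIV)
  then show ?thesis by (simp add: orth_projection_idem[OF Q(1)])
qed

text \<open>Half-lines receive \<open>E r\<close>, complements the complementary projection, and
  disjoint unions the sum of a series, whose orthogonality comes from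
  \<open>projections_of_disjoint\<close>.\<close>

lemma borel_projection_exists:
  assumes "A \<in> sets borel"
  shows "\<exists>P. orth_projection P \<and> (\<forall>x. (norm (P x))\<^sup>2 = measure (\<nu> x) A)"
proof -
  have sb: "sets borel = sigma_sets UNIV (range (atMost :: real \<Rightarrow> real set))"
    unfolding borel_eq_atMost by simp
  have "Int_stable (range (atMost :: real \<Rightarrow> real set))" by (auto simp: Int_stable_def)
  moreover have "range (atMost :: real \<Rightarrow> real set) \<subseteq> Pow UNIV" by simp
  moreover have "A \<in> sigma_sets UNIV (range atMost)" using assms sb by simp
  ultimately show ?thesis
  proof (induct A rule: sigma_sets_induct_disjoint)
    case (basic A)
    then obtain r where "A = {..r}" by blast
    then show ?case
      using orth_projection_E measure_\<nu>_atMost by (intro exI[of _ "E r"]) simp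
  next
    case empty
    show ?case using orth_projection_zero_map by (intro exI[of _ "\<lambda>_. 0"]) simp
  next
    case (compl A)
    then obtain P where P: "orth_projection P" "\<And>x. (norm (P x))\<^sup>2 = measure (\<nu> x) A" by blast
    have "(norm (proj_compl P x))\<^sup>2 = measure (\<nu> x) (UNIV - A)" for x
      using finite_measure.finite_measure_compl[OF finite_measure_\<nu>, of A x] compl(1) P
      by (simp add: proj_compl_def orth_projection_norm_diff measure_\<nu>_UNIV sb)
    then show ?case using orth_projection_proj_compl[OF P(1)] by blast
  next
    case (union A)
    from union(3) obtain P where P: "\<And>i. orth_projection (P i)"
      "\<And>i x. (norm (P i x))\<^sup>2 = measure (\<nu> x) (A i)" by metis
    have A: "A i \<in> sets borel" for i using union(2) sb by auto
    have "P i (P j x) = 0" if "i \<noteq> j" for i j x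
      using P A that union(1) projections_of_disjoint[of "P i" "A i" "P j" "A j"]
      by (auto simp: disjoint_family_on_def)
    then obtain Q where Q: "orth_projection Q" "\<And>x. (\<lambda>i. (norm (P i x))\<^sup>2) sums (norm (Q x))\<^sup>2"
      using orth_projection_sums[of P] P(1) by metis
    have "(\<lambda>i. measure (\<nu> x) (A i)) sums measure (\<nu> x) (\<Union>i. A i)" for x
      using A union(1) by (intro finite_measure.finite_measure_UNION[OF finite_measure_\<nu>]) auto
    then have "(norm (Q x))\<^sup>2 = measure (\<nu> x) (\<Union>i. A i)" for x
      using Q(2)[of x] sums_unique2 unfolding P(2) by blast
    then show ?case using Q(1) by blast
  qed
qed

lemma represents_indicator:
  assumes "A \<in> sets borel" "orth_projection P" "\<And>x. (norm (P x))\<^sup>2 = measure (\<nu> x) A"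
  shows "represents E (indicator A) P"
proof -
  have "(\<integral>t. indicator A t \<partial>\<nu> x) = complex_of_real (measure (\<nu> x) A)" for x
  proof -
    \<comment> \<open>Passing from the complex to the real indicator makes the integral a
      measure.\<close>
    have "(\<integral>t. indicator A t \<partial>\<nu> x) = (\<integral>t. complex_of_real (indicator A t) \<partial>\<nu> x)"
      by (intro Bochner_Integration.integral_cong) (auto simp: indicator_def)
    then show ?thesis by simp
  qed
  then show ?thesis
    unfolding represents_def using assms orth_projection_bounded_clinear
    by (simp add: orth_projection_quadratic del: of_real_power)
qed

lemma spectral_proj_eqI:
  "\<lbrakk>A \<in> sets borel; orth_projection P; \<And>x. (norm (P x))\<^sup>2 = measure (\<nu> x) A\<rbrakk> \<Longrightarrow> spectral_proj E A = P"
  unfolding spectral_proj_def by (rule fcalc_eqI[OF represents_indicator])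

lemma
  assumes "A \<in> sets borel"
  shows orth_projection_spectral_proj: "orth_projection (spectral_proj E A)"
    and norm_spectral_proj: "(norm (spectral_proj E A x))\<^sup>2 = measure (\<nu> x) A"
proof -
  obtain P where P: "orth_projection P" "\<And>x. (norm (P x))\<^sup>2 = measure (\<nu> x) A"
    using borel_projection_exists[OF assms] by blast
  then have "spectral_proj E A = P" by (rule spectral_proj_eqI[OF assms])
  with P show "orth_projection (spectral_proj E A)" "(norm (spectral_proj E A x))\<^sup>2 = measure (\<nu> x) A"
    by simp_all
qed

lemma spectral_proj_atMost: "spectral_proj E {..r} = E r"
  by (rule spectral_proj_eqI) (simp_all add: orth_projection_E measure_\<nu>_atMost)

lemma spectral_proj_empty: "spectral_proj E {} = (\<lambda>_. 0)"
  by (rule spectral_proj_eqI) (simp_all add: orth_projection_zero_map)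

lemma spectral_proj_compl:
  assumes "A \<in> sets borel"
  shows "spectral_proj E (- A) = proj_compl (spectral_proj E A)"
proof (rule spectral_proj_eqI)
  show "(norm (proj_compl (spectral_proj E A) x))\<^sup>2 = measure (\<nu> x) (- A)" for x
    using finite_measure.finite_measure_compl[OF finite_measure_\<nu>, of A x] assms
    by (simp add: proj_compl_def orth_projection_norm_diff orth_projection_spectral_proj
        norm_spectral_proj measure_\<nu>_UNIV Compl_eq_Diff_UNIV)
qed (use assms in \<open>auto intro: orth_projection_proj_compl orth_projection_spectral_proj\<close>)

lemma spectral_proj_UNIV: "spectral_proj E UNIV = id"
  by (rule spectral_proj_eqI) (simp_all add: orth_projection_id measure_\<nu>_UNIV)

lemma spectral_proj_disjoint:
  assumes "A \<in> sets borel" "B \<in> sets borel" "A \<inter> B = {}"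
  shows "spectral_proj E A (spectral_proj E B x) = 0"
  using assms
  by (intro projections_of_disjoint[of _ A _ B] orth_projection_spectral_proj norm_spectral_proj)

text \<open>The sum of the series is a projection whose squared norms are the measure of the union,
  and these norms identify it.\<close>

lemma spectral_proj_sums:
  assumes A: "\<And>i::nat. A i \<in> sets borel" "disjoint_family A"
  shows "(\<lambda>i. spectral_proj E (A i) x) sums spectral_proj E (\<Union>i. A i) x"
proof -
  have "spectral_proj E (A i) (spectral_proj E (A j) x) = 0" if "i \<noteq> j" for i j x
    using A that by (intro spectral_proj_disjoint) (auto simp: disjoint_family_on_def)
  then obtain Q where Q: "orth_projection Q" "\<And>x. (\<lambda>i. spectral_proj E (A i) x) sums Q x"
    "\<And>x. (\<lambda>i. (norm (spectral_proj E (A i) x))\<^sup>2) sums (norm (Q x))\<^sup>2"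
    using orth_projection_sums[of "\<lambda>i. spectral_proj E (A i)"] A(1) orth_projection_spectral_proj by metis
  have "(\<lambda>i. measure (\<nu> x) (A i)) sums measure (\<nu> x) (\<Union>i. A i)" for x
    using A by (intro finite_measure.finite_measure_UNION[OF finite_measure_\<nu>]) auto
  then have "(norm (Q x))\<^sup>2 = measure (\<nu> x) (\<Union>i. A i)" for x
    using Q(3)[of x] sums_unique2 unfolding norm_spectral_proj[OF A(1)] by blast
  then have "spectral_proj E (\<Union>i. A i) = Q"
    using A Q(1) by (intro spectral_proj_eqI) auto
  then show ?thesis using Q(2) by simp
qed

lemma spectral_proj_Un:
  assumes "A \<in> sets borel" "B \<in> sets borel" "A \<inter> B = {}"
  shows "spectral_proj E (A \<union> B) x = spectral_proj E A x + spectral_proj E B x"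
proof -
  have "disjoint_family (binaryset A B)"
    using assms(3) by (auto simp: disjoint_family_on_def binaryset_def)
  then have "(\<lambda>i. spectral_proj E (binaryset A B i) x) sums spectral_proj E (A \<union> B) x"
    using spectral_proj_sums[of "binaryset A B" x] assms(1,2)
    by (simp add: UN_binaryset_eq) (simp add: binaryset_def)
  moreover have "(\<lambda>i. spectral_proj E (binaryset A B i) x) sums (spectral_proj E A x + spectral_proj E B x)"
    using spectral_proj_empty by (intro binaryset_sums) simp
  ultimately show ?thesis by (rule sums_unique2)
qed

text \<open>Splitting \<open>A\<close> and \<open>B\<close> along their intersection leaves only
  products of projections onto disjoint sets, which vanish, and one square.\<close>

lemma spectral_proj_Int:
  assumes A: "A \<in> sets borel" and B: "B \<in> sets borel"
  shows "spectral_proj E (A \<inter> B) x = spectral_proj E A (spectral_proj E B x)"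
proof -
  note proj = orth_projection_spectral_proj
  have B_eq: "spectral_proj E B x = spectral_proj E (A \<inter> B) x + spectral_proj E (B - A) x"
  proof -
    have "A \<inter> B \<union> (B - A) = B" "A \<inter> B \<inter> (B - A) = {}" by blast+
    then show ?thesis using spectral_proj_Un[of "A \<inter> B" "B - A" x] A B by simp
  qed
  have A_eq: "spectral_proj E A y = spectral_proj E (A \<inter> B) y + spectral_proj E (A - B) y" for y
  proof -
    have "A \<inter> B \<union> (A - B) = A" "A \<inter> B \<inter> (A - B) = {}" by blast+
    then show ?thesis using spectral_proj_Un[of "A \<inter> B" "A - B" y] A B by simp
  qed
  have "spectral_proj E A (spectral_proj E B x) = spectral_proj E A (spectral_proj E (A \<inter> B) x)"
    unfolding B_eq
    using A B spectral_proj_disjoint[of A "B - A" x]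
    by (simp add: orth_projection_add[OF proj] Diff_disjoint)
  also have "\<dots> = spectral_proj E (A \<inter> B) x"
    unfolding A_eq[of "spectral_proj E (A \<inter> B) x"]
  proof -
    have "(A - B) \<inter> (A \<inter> B) = {}" by blast
    then show "spectral_proj E (A \<inter> B) (spectral_proj E (A \<inter> B) x)
        + spectral_proj E (A - B) (spectral_proj E (A \<inter> B) x) = spectral_proj E (A \<inter> B) x"
      using A B spectral_proj_disjoint[of "A - B" "A \<inter> B" x]
      by (simp add: orth_projection_idem[OF proj])
  qed
  finally show ?thesis by simp
qed

section \<open>Functional calculus for bounded Borel functions\<close>

lemma represents_add:
  assumes "f \<in> borel_measurable borel" "bounded (range f)" "represents E f S"
    and "g \<in> borel_measurable borel" "bounded (range g)" "represents E g T"
  shows "represents E (\<lambda>t. f t + g t) (\<lambda>x. S x + T x)"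
  using assms(3,6) integrable_\<nu>[OF assms(1,2)] integrable_\<nu>[OF assms(4,5)]
  by (simp add: represents_def bounded_clinear_add cinner_add_right)

lemma represents_scale:
  assumes "represents E f T"
  shows "represents E (\<lambda>t. c * f t) (\<lambda>x. c *\<^sub>C T x)"
  using assms by (simp add: represents_def bounded_clinear_scaleC cinner_scaleC_right)

text \<open>The quadratic form of the difference is the integral of \<open>f - g\<close>, which is
  at most \<open>e\<close> times the total mass.\<close>

lemma represents_norm_diff_le:
  assumes f: "f \<in> borel_measurable borel" "bounded (range f)" "represents E f S"
    and g: "g \<in> borel_measurable borel" "bounded (range g)" "represents E g T"
    and le: "\<And>t. cmod (f t - g t) \<le> e"
  shows "norm (S x - T x) \<le> 2 * e * norm x"
proof (rule norm_le_of_quadratic)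
  have "bounded_clinear (\<lambda>x. S x - T x)"
    using f(3) g(3) by (intro bounded_clinear_diff) (auto simp: represents_def)
  then show "clinear (\<lambda>x. S x - T x)" by (simp add: bounded_clinear_def)
  show "cmod (cinner x (S x - T x)) \<le> e * (norm x)\<^sup>2" for x
  proof -
    have "cinner x (S x - T x) = (\<integral>t. f t - g t \<partial>\<nu> x)"
      using f(3) g(3) integrable_\<nu>[OF f(1,2), of x] integrable_\<nu>[OF g(1,2), of x]
      by (simp add: represents_def cinner.diff_right)
    then show ?thesis using f(1) g(1) le by (simp add: cmod_integral_\<nu>_le)
  qed
qed

text \<open>The operators are Cauchy at every vector by the previous estimate. The form of the
  pointwise limit is the limit of the integrals, since the measures are finite, and a bound on
  \<open>f\<close> bounds the limit operator.\<close>

lemma represents_uniform_limit: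
  assumes F: "\<And>n. F n \<in> borel_measurable borel" "\<And>n. bounded (range (F n))" "\<And>n. represents E (F n) (T n)"
    and f: "f \<in> borel_measurable borel" "bounded (range f)"
    and le: "\<And>n t. cmod (F n t - f t) \<le> 1 / Suc n"
  shows "\<exists>S. represents E f S"
proof -
  have T_diff: "norm (T m x - T n x) \<le> 2 * (1 / Suc m + 1 / Suc n) * norm x" for m n x
  proof (rule represents_norm_diff_le[OF F F])
    show "cmod (F m t - F n t) \<le> 1 / Suc m + 1 / Suc n" for t
      using norm_triangle_ineq4[of "F m t - f t" "F n t - f t"] le[of m t] le[of n t] by simp
  qed
  have T: "bounded_clinear (T n)" "cinner x (T n x) = (\<integral>t. F n t \<partial>\<nu> x)" for n x
    using F(3) by (auto simp: represents_def)
  have small: "(\<lambda>n. c * (1 / Suc n)) \<longlonglongrightarrow> 0" for c :: real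
    using tendsto_mult_right_zero[OF LIMSEQ_inverse_real_of_nat, of c] by (simp only: inverse_eq_divide)
  have "convergent (\<lambda>n. T n x)" for x
  proof (rule Cauchy_convergent, rule CauchyI)
    fix e :: real assume "0 < e"
    then have "eventually (\<lambda>n. 2 * norm x * (1 / Suc n) < e / 2) sequentially"
      using order_tendstoD(2)[OF small, of "e / 2" "2 * norm x"] by simp
    then obtain N where N: "\<And>n. n \<ge> N \<Longrightarrow> 2 * norm x * (1 / Suc n) < e / 2"
      by (auto simp: eventually_sequentially)
    have "norm (T m x - T n x) < e" if "m \<ge> N" "n \<ge> N" for m n
    proof -
      have "norm (T m x - T n x) \<le> 2 * norm x * (1 / Suc m) + 2 * norm x * (1 / Suc n)"
        using T_diff[of m x n] by (simp only: algebra_simps)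
      then show ?thesis using N[OF that(1)] N[OF that(2)] by linarith
    qed
    then show "\<exists>N. \<forall>m\<ge>N. \<forall>n\<ge>N. norm (T m x - T n x) < e" by blast
  qed
  then obtain S where S: "\<And>x. (\<lambda>n. T n x) \<longlonglongrightarrow> S x" unfolding convergent_def by metis
  have T_lin: "T n (x + y) = T n x + T n y" "T n (c *\<^sub>C x) = c *\<^sub>C T n x" for n c x y
    using T(1) by (simp_all add: bounded_clinear_def clinear_def)
  have "clinear S"
    unfolding clinear_def
  proof safe
    fix x y
    have "(\<lambda>n. T n (x + y)) \<longlonglongrightarrow> S x + S y" unfolding T_lin by (intro tendsto_add S)
    then show "S (x + y) = S x + S y" by (rule LIMSEQ_unique[OF S])
  next
    fix c x
    have "(\<lambda>n. T n (c *\<^sub>C x)) \<longlonglongrightarrow> c *\<^sub>C S x"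
      unfolding T_lin by (rule bounded_linear.tendsto[OF bounded_linear_scaleC S])
    then show "S (c *\<^sub>C x) = c *\<^sub>C S x" by (rule LIMSEQ_unique[OF S])
  qed
  have quad: "cinner x (S x) = (\<integral>t. f t \<partial>\<nu> x)" for x
  proof (rule LIMSEQ_unique)
    show "(\<lambda>n. cinner x (T n x)) \<longlonglongrightarrow> cinner x (S x)" by (intro cinner.tendsto tendsto_const S)
    have "norm (cinner x (T n x) - (\<integral>t. f t \<partial>\<nu> x)) \<le> (norm x)\<^sup>2 * (1 / Suc n)" for n
    proof -
      have "cinner x (T n x) - (\<integral>t. f t \<partial>\<nu> x) = (\<integral>t. F n t - f t \<partial>\<nu> x)"
        using integrable_\<nu>[OF F(1,2), of x] integrable_\<nu>[OF f, of x] by (simp add: T)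
      also have "norm \<dots> \<le> (1 / Suc n) * (norm x)\<^sup>2"
        using F(1) f(1) le by (intro cmod_integral_\<nu>_le) auto
      finally show ?thesis by (simp only: mult.commute)
    qed
    then have "(\<lambda>n. cinner x (T n x) - (\<integral>t. f t \<partial>\<nu> x)) \<longlonglongrightarrow> 0"
      by (intro Lim_null_comparison[OF always_eventually small]) blast
    then show "(\<lambda>n. cinner x (T n x)) \<longlonglongrightarrow> (\<integral>t. f t \<partial>\<nu> x)" by (simp add: LIM_zero_iff)
  qed
  obtain b where b: "\<And>t. cmod (f t) \<le> b" using f(2) by (auto simp: bounded_iff)
  have "norm (S x) \<le> 2 * b * norm x" for x
    using \<open>clinear S\<close>
  proof (rule norm_le_of_quadratic)
    show "cmod (cinner x (S x)) \<le> b * (norm x)\<^sup>2" for x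
      unfolding quad using f(1) b by (rule cmod_integral_\<nu>_le)
  qed
  then have "bounded_clinear S" by (rule bounded_clinearI[OF \<open>clinear S\<close>])
  then show ?thesis using quad by (auto simp: represents_def)
qed

lemma represents_fcalc:
  assumes "f \<in> borel_measurable borel" "bounded (range f)"
  shows "represents E f (fcalc E f)"
proof -
  from assms have "\<exists>T. represents E f T"
  proof (induct f rule: bounded_borel_induct)
    case (indicator A)
    then show ?case using borel_projection_exists represents_indicator by blast
  next
    case (add f g)
    then show ?case using represents_add by blast
  next
    case (scale c f)
    then show ?case using represents_scale by blast
  next
    case (lim F f)
    from lim(3) obtain T where "\<And>n. represents E (F n) (T n)" by metis
    with lim show ?case by (intro represents_uniform_limit[of F T f])
  qed
  then show ?thesis using fcalc_eqI by metis
qed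

lemma fcalc_add:
  assumes "f \<in> borel_measurable borel" "bounded (range f)" "g \<in> borel_measurable borel" "bounded (range g)"
  shows "fcalc E (\<lambda>t. f t + g t) = (\<lambda>x. fcalc E f x + fcalc E g x)"
  using assms by (intro fcalc_eqI represents_add represents_fcalc)

lemma fcalc_scale:
  assumes "f \<in> borel_measurable borel" "bounded (range f)"
  shows "fcalc E (\<lambda>t. c * f t) = (\<lambda>x. c *\<^sub>C fcalc E f x)"
  using assms by (intro fcalc_eqI represents_scale represents_fcalc)

lemma fcalc_uniform_limit:
  assumes F: "\<And>n. F n \<in> borel_measurable borel" "\<And>n. bounded (range (F n))"
    and f: "f \<in> borel_measurable borel" "bounded (range f)"
    and le: "\<And>n t. cmod (F n t - f t) \<le> 1 / Suc n"
  shows "(\<lambda>n. fcalc E (F n) x) \<longlonglongrightarrow> fcalc E f x"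
proof -
  have "norm (fcalc E (F n) x - fcalc E f x) \<le> 2 * (1 / Suc n) * norm x" for n
    by (rule represents_norm_diff_le[OF F represents_fcalc[OF F] f represents_fcalc[OF f] le])
  moreover have "(\<lambda>n. 2 * (1 / Suc n) * norm x) \<longlonglongrightarrow> 0"
    using LIMSEQ_inverse_real_of_nat
    by (intro tendsto_mult_left_zero tendsto_mult_right_zero) (simp only: inverse_eq_divide)
  ultimately have "(\<lambda>n. fcalc E (F n) x - fcalc E f x) \<longlonglongrightarrow> 0"
    by (rule Lim_null_comparison[OF always_eventually[OF allI]])
  then show ?thesis by (simp add: LIM_zero_iff)
qed

end

section \<open>Two resolutions of identity agreeing on a vector\<close>

locale two_resolutions = A: spectral_resolution E + B: spectral_resolution F
  for E F :: "real \<Rightarrow> 'a::chilbert_space \<Rightarrow> 'a"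
begin

section \<open>From agreement at rationals to Borel sets and functions\<close>

lemma agree_rat_imp_agree:
  assumes "\<And>r::rat. E (of_rat r) \<psi> = F (of_rat r) \<psi>"
  shows "E s \<psi> = F s \<psi>"
proof -
  \<comment> \<open>Rationals strictly above \<open>s\<close>, as convergence along
    \<open>at_right s\<close> demands.\<close>
  have "\<exists>u. \<forall>n. u n > s \<and> u n < s + inverse (Suc n) \<and> u n \<in> \<rat>"
    by (intro choice allI) (metis Rats_dense_in_real inverse_positive_iff_positive less_add_same_cancel1 of_nat_0_less_iff zero_less_Suc)
  then obtain u :: "nat \<Rightarrow> real" where u: "\<And>n. u n > s" "\<And>n. u n < s + inverse (Suc n)" "\<And>n. u n \<in> \<rat>" by blast
  have "u \<longlonglongrightarrow> s"
    by (rule tendsto_sandwich[OF always_eventually always_eventually tendsto_const LIMSEQ_inverse_real_of_nat_add[of s]])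
      (simp_all only: less_imp_le u simp_thms)
  then have u_right: "filterlim u (at_right s) sequentially"
    using u(1) by (auto simp: filterlim_at intro!: always_eventually)
  have "(\<lambda>n. E (u n) \<psi>) \<longlonglongrightarrow> E s \<psi>" "(\<lambda>n. F (u n) \<psi>) \<longlonglongrightarrow> F s \<psi>"
    using A.resolution B.resolution unfolding resolution_of_identity_def
    by (auto intro: filterlim_compose[OF _ u_right])
  moreover have "E (u n) \<psi> = F (u n) \<psi>" for n
    using u(3)[of n] assms by (auto elim!: Rats_cases)
  ultimately show ?thesis using LIMSEQ_unique by simp
qed

text \<open>The Borel sets on which the projections agree at \<psi> include the half-lines and are
  closed under complements and disjoint unions, the latter by uniqueness of sums.\<close>

lemma agree_imp_spectral_proj_agree:
  assumes "\<And>s. E s \<psi> = F s \<psi>" and "A \<in> sets borel"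
  shows "spectral_proj E A \<psi> = spectral_proj F A \<psi>"
proof -
  have sb: "sets borel = sigma_sets UNIV (range (atMost :: real \<Rightarrow> real set))"
    unfolding borel_eq_atMost by simp
  have "Int_stable (range (atMost :: real \<Rightarrow> real set))" by (auto simp: Int_stable_def)
  moreover have "range (atMost :: real \<Rightarrow> real set) \<subseteq> Pow UNIV" by simp
  moreover have "A \<in> sigma_sets UNIV (range atMost)" using assms sb by simp
  ultimately show ?thesis
  proof (induct A rule: sigma_sets_induct_disjoint)
    case (basic A)
    then show ?case using assms(1) by (auto simp: A.spectral_proj_atMost B.spectral_proj_atMost)
  next
    case empty
    then show ?case by (simp add: A.spectral_proj_empty B.spectral_proj_empty)
  next
    case (compl A)
    then show ?case
      by (simp add: Compl_eq_Diff_UNIV[symmetric] A.spectral_proj_compl B.spectral_proj_compl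
          proj_compl_def flip: sb)
  next
    case (union A)
    then have A: "A i \<in> sets borel" for i using sb by auto
    show ?case
      using A.spectral_proj_sums[OF A union(1), of \<psi>] B.spectral_proj_sums[OF A union(1), of \<psi>]
      unfolding union(3) by (rule sums_unique2)
  qed
qed

lemma agree_imp_fcalc_agree:
  assumes "\<And>s. E s \<psi> = F s \<psi>" and "f \<in> borel_measurable borel" "bounded (range f)"
  shows "fcalc E f \<psi> = fcalc F f \<psi>"
  using assms(2,3)
proof (induct f rule: bounded_borel_induct)
  case (indicator A)
  then show ?case
    using agree_imp_spectral_proj_agree[OF assms(1)] by (simp add: spectral_proj_def)
next
  case (lim G f)
  show ?case
    using A.fcalc_uniform_limit[OF lim(1,2,4-6), of \<psi>] B.fcalc_uniform_limit[OF lim(1,2,4-6), of \<psi>]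
    unfolding lim(3) by (rule LIMSEQ_unique)
qed (simp_all add: A.fcalc_add B.fcalc_add A.fcalc_scale B.fcalc_scale)

section \<open>Orthogonality over disjoint sets\<close>

text \<open>A half-line paired with its complement, in both orders, makes
  \<open>cinner (E r \<psi>) (F r \<psi>)\<close> equal to both squared norms, so the difference has
  norm zero.\<close>

lemma orthogonal_imp_agree:
  assumes "\<And>\<Delta> \<Gamma>. \<lbrakk>\<Delta> \<in> sets borel; \<Gamma> \<in> sets borel; \<Delta> \<inter> \<Gamma> = {}\<rbrakk> \<Longrightarrow>
    cinner (spectral_proj E \<Delta> \<psi>) (spectral_proj F \<Gamma> \<psi>) = 0"
  shows "E r \<psi> = F r \<psi>"
proof -
  note PA = A.orth_projection_E[of r] and PB = B.orth_projection_E[of r]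
  have compl: "spectral_proj E (- {..r}) \<psi> = \<psi> - E r \<psi>" "spectral_proj F (- {..r}) \<psi> = \<psi> - F r \<psi>"
    using A.spectral_proj_compl[of "{..r}"] B.spectral_proj_compl[of "{..r}"]
    by (simp_all add: A.spectral_proj_atMost B.spectral_proj_atMost proj_compl_def)
  have "cinner (E r \<psi>) (\<psi> - F r \<psi>) = 0"
    using assms[of "{..r}" "- {..r}"] unfolding A.spectral_proj_atMost compl by (simp del: Compl_atMost)
  moreover have "cinner (\<psi> - E r \<psi>) (F r \<psi>) = 0"
    using assms[of "- {..r}" "{..r}"] unfolding B.spectral_proj_atMost compl by (simp del: Compl_atMost)
  moreover have "cinner (E r \<psi>) (\<psi> - E r \<psi>) = 0" "cinner (F r \<psi>) (\<psi> - F r \<psi>) = 0"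
    by (intro orth_projection_orthogonal PA PB rangeI)+
  ultimately have "cinner (E r \<psi> - F r \<psi>) (E r \<psi> - F r \<psi>) = 0"
    using orth_projection_adjoint[OF PA, of \<psi> \<psi>] orth_projection_adjoint[OF PB, of \<psi> \<psi>]
      orth_projection_adjoint[OF PB, of \<psi> "E r \<psi>"]
    by (simp add: cinner.diff_left cinner.diff_right)
      (metis cinner_commute orth_projection_adjoint[OF PA] orth_projection_adjoint[OF PB])
  then show ?thesis by (simp add: cinner_self)
qed

lemma agree_imp_orthogonal:
  assumes "\<And>s. E s \<psi> = F s \<psi>" "\<Delta> \<in> sets borel" "\<Gamma> \<in> sets borel" "\<Delta> \<inter> \<Gamma> = {}"
  shows "cinner (spectral_proj E \<Delta> \<psi>) (spectral_proj F \<Gamma> \<psi>) = 0"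
proof -
  have "cinner (spectral_proj E \<Delta> \<psi>) (spectral_proj F \<Gamma> \<psi>)
      = cinner (spectral_proj E \<Delta> \<psi>) (spectral_proj E \<Gamma> \<psi>)"
    by (simp add: agree_imp_spectral_proj_agree[OF assms(1,3)])
  also have "\<dots> = cinner \<psi> (spectral_proj E \<Delta> (spectral_proj E \<Gamma> \<psi>))"
    by (rule orth_projection_adjoint[OF A.orth_projection_spectral_proj[OF assms(2)]])
  finally show ?thesis using A.spectral_proj_disjoint[OF assms(2-4)] by simp
qed

section \<open>Joint distributions\<close>

text \<open>The two projections need not commute, so the meet is evaluated at \<psi> alone: the
  claimed value lies in both ranges, and its difference from \<psi> is orthogonal to their
  intersection.\<close>

lemma agree_imp_meet:
  assumes agree: "\<And>s. E s \<psi> = F s \<psi>" and D: "\<Delta> \<in> sets borel" and G: "\<Gamma> \<in> sets borel"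
  shows "(spectral_proj E \<Delta> \<sqinter>\<^sub>p spectral_proj F \<Gamma>) \<psi> = spectral_proj E (\<Delta> \<inter> \<Gamma>) \<psi>"
proof -
  note PA = A.orth_projection_spectral_proj[OF D] and PB = B.orth_projection_spectral_proj[OF G]
  note eq = agree_imp_spectral_proj_agree[OF agree]
  show ?thesis
    unfolding proj_inf_def
  proof (rule proj_onto_apply_eqI)
    show "csubspace (range (spectral_proj E \<Delta>) \<inter> range (spectral_proj F \<Gamma>))"
      by (intro csubspace_Int csubspace_range PA PB)
    show "closed (range (spectral_proj E \<Delta>) \<inter> range (spectral_proj F \<Gamma>))"
      by (intro closed_Int closed_range PA PB)
    have "spectral_proj E (\<Delta> \<inter> \<Gamma>) \<psi> = spectral_proj E \<Delta> (spectral_proj E \<Gamma> \<psi>)"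
      by (rule A.spectral_proj_Int[OF D G])
    \<comment> \<open>Agreement on the intersection rewrites the same vector with the projection of
      \<open>F\<close> outermost.\<close>
    moreover have "spectral_proj E (\<Delta> \<inter> \<Gamma>) \<psi> = spectral_proj F \<Gamma> (spectral_proj F \<Delta> \<psi>)"
      using B.spectral_proj_Int[OF G D] eq[of "\<Delta> \<inter> \<Gamma>"] D G by (simp add: Int_commute)
    ultimately show "spectral_proj E (\<Delta> \<inter> \<Gamma>) \<psi> \<in> range (spectral_proj E \<Delta>) \<inter> range (spectral_proj F \<Gamma>)"
      by (metis IntI rangeI)
    fix w assume "w \<in> range (spectral_proj E \<Delta>) \<inter> range (spectral_proj F \<Gamma>)"
    then have w: "spectral_proj E \<Delta> w = w" "spectral_proj F \<Gamma> w = w"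
      using orth_projection_range_iff[OF PA, of w] orth_projection_range_iff[OF PB, of w] by simp_all
    \<comment> \<open>As \<open>w\<close> is fixed by both projections, each can be moved onto it
      and dropped, agreement on \<Gamma> switching from \<open>E\<close> to \<open>F\<close> in
      between.\<close>
    have "cinner w (spectral_proj E (\<Delta> \<inter> \<Gamma>) \<psi>) = cinner w (spectral_proj F \<Gamma> \<psi>)"
      using orth_projection_adjoint[OF PA, of w "spectral_proj E \<Gamma> \<psi>"]
      by (simp add: A.spectral_proj_Int[OF D G] w eq[OF G])
    also have "\<dots> = cinner w \<psi>"
      using orth_projection_adjoint[OF PB, of w \<psi>] by (simp add: w)
    finally show "cinner w (\<psi> - spectral_proj E (\<Delta> \<inter> \<Gamma>) \<psi>) = 0" by (simp add: cinner.diff_right)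
  qed
qed

lemma agree_imp_joint_distribution:
  assumes agree: "\<And>s. E s \<psi> = F s \<psi>" and norm: "norm \<psi> = 1"
  shows "\<exists>\<mu>. joint_distribution E F \<psi> \<mu> \<and> measure \<mu> {(a, b). a = b} = 1"
proof -
  \<comment> \<open>Pushing forward along the diagonal map puts all mass on the diagonal and pulls a
    rectangle back to the intersection of its sides.\<close>
  define \<mu> :: "(real \<times> real) measure" where "\<mu> = distr (A.\<nu> \<psi>) borel (\<lambda>t. (t, t))"
  have m: "(\<lambda>t. (t, t)) \<in> A.\<nu> \<psi> \<rightarrow>\<^sub>M (borel :: (real \<times> real) measure)"
    by (simp add: borel_prod[symmetric])
  interpret prob_space "A.\<nu> \<psi>"
    using A.finite_measure_\<nu> A.measure_\<nu>_UNIV[of \<psi>] norm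
    by (intro prob_spaceI) (simp add: finite_measure.emeasure_eq_measure)
  have meas: "measure \<mu> S = measure (A.\<nu> \<psi>) ((\<lambda>t. (t, t)) -` S)" if "S \<in> sets borel" for S
    unfolding \<mu>_def using measure_distr[OF m, of S] that by simp
  have "joint_distribution E F \<psi> \<mu>"
    unfolding joint_distribution_def
  proof (intro conjI ballI)
    show "prob_space \<mu>" unfolding \<mu>_def using m by (rule prob_space_distr)
    show "sets \<mu> = sets borel" by (simp add: \<mu>_def)
    fix \<Delta> \<Gamma> :: "real set" assume DG: "\<Delta> \<in> sets borel" "\<Gamma> \<in> sets borel"
    then have "\<Delta> \<times> \<Gamma> \<in> sets borel" by (simp add: borel_prod[symmetric])
    then have "measure \<mu> (\<Delta> \<times> \<Gamma>) = measure (A.\<nu> \<psi>) (\<Delta> \<inter> \<Gamma>)"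
      by (simp add: meas vimage_def Int_def)
    then show "complex_of_real (measure \<mu> (\<Delta> \<times> \<Gamma>)) =
        cinner \<psi> ((spectral_proj E \<Delta> \<sqinter>\<^sub>p spectral_proj F \<Gamma>) \<psi>)"
      using DG by (simp add: agree_imp_meet[OF agree] A.orth_projection_spectral_proj
          orth_projection_quadratic A.norm_spectral_proj del: of_real_power)
  qed
  moreover have "{(a, b). a = b} \<in> sets (borel :: (real \<times> real) measure)"
    by (intro borel_closed) (simp add: case_prod_unfold closed_Collect_eq continuous_intros)
  then have "measure \<mu> {(a, b). a = b} = 1"
    using prob_space by (simp add: meas vimage_def)
  ultimately show ?thesis by blast
qed

text \<open>
  Mass concentrated on the diagonal gives \<open>(-\<infinity>, r] \<times> (-\<infinity>, r]\<close>, \<open>(-\<infinity>, r] \<times> \<real>\<close> and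
  \<open>\<real> \<times> (-\<infinity>, r]\<close> the same measure, so the meet of \<open>E r\<close> and \<open>F r\<close> shortens \<open>\<psi>\<close> as
  little as either of them.
\<close>

lemma joint_distribution_imp_agree:
  assumes joint: "joint_distribution E F \<psi> \<mu>" and diag: "measure \<mu> {(a, b). a = b} = 1"
  shows "E r \<psi> = F r \<psi>"
proof -
  interpret prob_space \<mu> using joint by (simp add: joint_distribution_def)
  have sets: "sets \<mu> = sets borel" using joint by (simp add: joint_distribution_def)
  have prod_sets: "\<Delta> \<times> \<Gamma> \<in> sets \<mu>" if "\<Delta> \<in> sets borel" "\<Gamma> \<in> sets borel" for \<Delta> \<Gamma> :: "real set"
    unfolding sets using that by (simp add: borel_prod[symmetric])
  have val: "complex_of_real (measure \<mu> (\<Delta> \<times> \<Gamma>)) = cinner \<psi> ((spectral_proj E \<Delta> \<sqinter>\<^sub>p spectral_proj F \<Gamma>) \<psi>)"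
    if "\<Delta> \<in> sets borel" "\<Gamma> \<in> sets borel" for \<Delta> \<Gamma>
    using joint that by (simp add: joint_distribution_def)
  have diag_sets: "{(a, b). a = b} \<in> sets \<mu>"
    unfolding sets by (intro borel_closed) (simp add: case_prod_unfold closed_Collect_eq continuous_intros)
  have ae: "AE z in \<mu>. z \<in> {(a, b). a = b}"
    using diag diag_sets by (simp add: prob_eq_1)
  define R where "R = E r \<sqinter>\<^sub>p F r"
  note PA = A.orth_projection_E[of r] and PB = B.orth_projection_E[of r]
  have R: "orth_projection R" "range R = range (E r) \<inter> range (F r)"
    unfolding R_def by (rule orth_projection_proj_inf[OF PA PB] range_proj_inf[OF PA PB])+
  \<comment> \<open>On the diagonal, \<open>a \<le> r\<close> and \<open>b \<le> r\<close> are the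
    same condition.\<close>
  have mA: "measure \<mu> ({..r} \<times> {..r}) = measure \<mu> ({..r} \<times> UNIV)"
    and mB: "measure \<mu> ({..r} \<times> {..r}) = measure \<mu> (UNIV \<times> {..r})"
    using ae by (auto intro!: measure_eq_AE prod_sets)
  \<comment> \<open>A whole line as one side gives the identity projection, so the marginals of the
    distribution are those of \<open>E\<close> and \<open>F\<close>.\<close>
  have id_inf: "P \<sqinter>\<^sub>p id = P" "id \<sqinter>\<^sub>p P = P" if "orth_projection P" for P :: "'a \<Rightarrow> 'a"
    using that by (simp_all add: proj_inf_def)
  have "complex_of_real ((norm (R \<psi>))\<^sup>2) = complex_of_real ((norm (E r \<psi>))\<^sup>2)"
    using val[of "{..r}" "{..r}"] val[of "{..r}" UNIV] mA
    by (simp add: A.spectral_proj_atMost B.spectral_proj_atMost B.spectral_proj_UNIV id_inf[OF PA]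
        orth_projection_quadratic[OF R(1)] orth_projection_quadratic[OF PA] flip: R_def del: of_real_power)
  then have nA: "(norm (R \<psi>))\<^sup>2 = (norm (E r \<psi>))\<^sup>2" using of_real_eq_iff by blast
  have "complex_of_real ((norm (R \<psi>))\<^sup>2) = complex_of_real ((norm (F r \<psi>))\<^sup>2)"
    using val[of "{..r}" "{..r}"] val[of UNIV "{..r}"] mB
    by (simp add: A.spectral_proj_atMost B.spectral_proj_atMost A.spectral_proj_UNIV id_inf[OF PB]
        orth_projection_quadratic[OF R(1)] orth_projection_quadratic[OF PB] flip: R_def del: of_real_power)
  then have nB: "(norm (R \<psi>))\<^sup>2 = (norm (F r \<psi>))\<^sup>2" using of_real_eq_iff by blast
  \<comment> \<open>Since \<open>R\<close> lies below \<open>P\<close>, it sends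
    \<open>P \<psi>\<close> to \<open>R \<psi>\<close>; with equal norms, Pythagoras for
    \<open>R\<close> at \<open>P \<psi>\<close> leaves no remainder.\<close>
  have "P \<psi> = R \<psi>" if P: "orth_projection P" "range R \<subseteq> range P" and n: "(norm (R \<psi>))\<^sup>2 = (norm (P \<psi>))\<^sup>2" for P
  proof -
    have P_R: "P (R x) = R x" for x using P orth_projection_range_iff[OF P(1), of "R x"] by auto
    have "R (P \<psi>) = R \<psi>"
    proof (rule cinner_ext)
      show "cinner z (R (P \<psi>)) = cinner z (R \<psi>)" for z
        using orth_projection_adjoint[OF P(1), of "R z" \<psi>]
        by (simp add: P_R flip: orth_projection_adjoint[OF R(1)])
    qed
    then show ?thesis using orth_projection_norm_diff[OF R(1), of "P \<psi>"] n by simp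
  qed
  from this[OF PA _ nA] this[OF PB _ nB] R(2) show ?thesis by simp
qed

end

theorem theorem6p3:
  fixes A B :: "('a::chilbert_space \<times> 'a) set"
    and E\<^sub>A E\<^sub>B :: "real \<Rightarrow> 'a \<Rightarrow> 'a"
    and \<psi> :: 'a
  assumes "self_adjoint A" and "self_adjoint B"
    and "resolution_of A E\<^sub>A" and "resolution_of B E\<^sub>B"
    and "norm \<psi> = 1"
  shows
    "(\<psi> \<in> range (qeq (qreal E\<^sub>A) (qreal E\<^sub>B))
        \<longleftrightarrow> (\<forall>r::rat. E\<^sub>A (of_rat r) \<psi> = E\<^sub>B (of_rat r) \<psi>)) \<and>
     (\<psi> \<in> range (qeq (qreal E\<^sub>A) (qreal E\<^sub>B))
        \<longleftrightarrow> (\<forall>f \<in> borel_measurable borel. bounded (range f) \<longrightarrow> fcalc E\<^sub>A f \<psi> = fcalc E\<^sub>B f \<psi>)) \<and>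
     (\<psi> \<in> range (qeq (qreal E\<^sub>A) (qreal E\<^sub>B))
        \<longleftrightarrow> (\<forall>\<Delta> \<in> sets borel. \<forall>\<Gamma> \<in> sets borel. \<Delta> \<inter> \<Gamma> = {} \<longrightarrow>
              cinner (spectral_proj E\<^sub>A \<Delta> \<psi>) (spectral_proj E\<^sub>B \<Gamma> \<psi>) = 0)) \<and>
     (\<psi> \<in> range (qeq (qreal E\<^sub>A) (qreal E\<^sub>B))
        \<longleftrightarrow> (\<exists>\<mu>. joint_distribution E\<^sub>A E\<^sub>B \<psi> \<mu> \<and> measure \<mu> {(a, b). a = b} = 1))"
proof -
  interpret two_resolutions E\<^sub>A E\<^sub>B
    using assms by unfold_locales (auto simp: resolution_of_def)
  \<comment> \<open>Agreement at all real \<open>s\<close> is the common condition to which the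
    others are reduced.\<close>
  let ?agree = "\<forall>s. E\<^sub>A s \<psi> = E\<^sub>B s \<psi>"
  have "\<psi> \<in> range (qeq (qreal E\<^sub>A) (qreal E\<^sub>B)) \<longleftrightarrow> (\<forall>r::rat. E\<^sub>A (of_rat r) \<psi> = E\<^sub>B (of_rat r) \<psi>)"
    by (rule range_qeq_qreal) (rule A.orth_projection_E B.orth_projection_E)+
  moreover have "(\<forall>r::rat. E\<^sub>A (of_rat r) \<psi> = E\<^sub>B (of_rat r) \<psi>) \<longleftrightarrow> ?agree"
    using agree_rat_imp_agree by blast
  moreover have "?agree \<longleftrightarrow>
      (\<forall>f \<in> borel_measurable borel. bounded (range f) \<longrightarrow> fcalc E\<^sub>A f \<psi> = fcalc E\<^sub>B f \<psi>)"
  proof (intro iffI ballI impI allI)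
    fix s assume *: "\<forall>f \<in> borel_measurable borel. bounded (range f) \<longrightarrow> fcalc E\<^sub>A f \<psi> = fcalc E\<^sub>B f \<psi>"
    \<comment> \<open>Half-line indicators are admissible functions, and their functional calculus
      returns the resolution itself.\<close>
    have "bounded (range (indicator {..s} :: real \<Rightarrow> complex))"
      by (auto simp: bounded_iff indicator_def intro!: exI[of _ 1])
    then have "spectral_proj E\<^sub>A {..s} \<psi> = spectral_proj E\<^sub>B {..s} \<psi>"
      using * unfolding spectral_proj_def by simp
    then show "E\<^sub>A s \<psi> = E\<^sub>B s \<psi>" by (simp add: A.spectral_proj_atMost B.spectral_proj_atMost)
  qed (rule agree_imp_fcalc_agree, blast+)
  moreover have "?agree \<longleftrightarrow> (\<forall>\<Delta> \<in> sets borel. \<forall>\<Gamma> \<in> sets borel. \<Delta> \<inter> \<Gamma> = {} \<longrightarrow>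
              cinner (spectral_proj E\<^sub>A \<Delta> \<psi>) (spectral_proj E\<^sub>B \<Gamma> \<psi>) = 0)"
    using agree_imp_orthogonal orthogonal_imp_agree by (intro iffI ballI impI allI) blast+
  moreover have "?agree \<longleftrightarrow> (\<exists>\<mu>. joint_distribution E\<^sub>A E\<^sub>B \<psi> \<mu> \<and> measure \<mu> {(a, b). a = b} = 1)"
    using agree_imp_joint_distribution[OF _ assms(5)] joint_distribution_imp_agree by blast
  ultimately show ?thesis by blast
qed

end
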